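(* As $x\to\infty$, $$I(x)=\frac{3}{2\pi^2}(\log x)^2+\frac{6}{\pi^2}(\log x)(\log\log x)+\frac{3}{\pi^2}\log\left(\frac{6\sqrt3}{\pi^2}\right)\log x+O\bigl((\log\log x)^2\bigr).$$ In particular, $$I(x)\sim\frac{3}{2\pi^2}(\log x)^2 .$$
   Context: $p(n)$ denotes the number of (unrestricted) partitions of the positive integer $n$, and $H(n):=p(n)-n$. The positive range is $\mathcal{H}^+:=\{H(n):n\ge 4\}$, regarded as a set of positive integers. For real $x$, $I(x):=\#\{m\in\mathcal{H}^+: m\le x\}$. $\log$ is the natural logarithm. *)

theory Defs
  imports Complex_Main "HOL-Library.Multiset" "HOL-Library.Landau_Symbols"
begin

definition partitions_of :: "nat \<Rightarrow> nat multiset set" where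
  "partitions_of n = {N. 0 \<notin># N \<and> sum_mset N = n}"

definition num_partitions :: "nat \<Rightarrow> nat" where
  "num_partitions n = card (partitions_of n)"

text \<open>The difference is taken in the integers, as subtraction on the naturals truncates.\<close>

definition H :: "nat \<Rightarrow> int" where
  "H n = int (num_partitions n) - int n"

definition H_plus :: "int set" where
  "H_plus = {H n | n. n \<ge> 4}"

definition I_count :: "real \<Rightarrow> nat" where
  "I_count x = card {m \<in> H_plus. real_of_int m \<le> x}"

text \<open>Both cardinalities above are those of finite sets, and \<open>H_plus\<close> consists of positive integers.\<close>

lemma finite_partitions_of: "finite (partitions_of n)"
proof (rule finite_subset)
  show "partitions_of n \<subseteq> mset ` {xs. set xs \<subseteq> {..n} \<and> length xs \<le> n}"
  proof
    fix N assume N: "N \<in> partitions_of n"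
    obtain xs where xs: "N = mset xs" by (metis ex_mset)
    have s: "sum_list xs = n" and z: "0 \<notin> set xs"
      using N by (auto simp: partitions_of_def xs sum_mset_sum_list)
    have "set xs \<subseteq> {..n}" using s by (auto simp: member_le_sum_list)
    moreover have "length xs \<le> sum_list xs" using z by (induction xs) auto
    ultimately show "N \<in> mset ` {xs. set xs \<subseteq> {..n} \<and> length xs \<le> n}"
      using xs s by auto
  qed
qed (simp add: finite_lists_length_le)

lemma H_pos: assumes "n \<ge> 4" shows "H n > 0"
proof -
  define f where "f k = add_mset (n - k) (replicate_mset k (1::nat))" for k
  define N where "N = add_mset 2 (add_mset 2 (replicate_mset (n - 4) (1::nat)))"
  have "inj_on f {..<n}"
    by (rule inj_on_inverseI[where g = "\<lambda>M. size M - 1"]) (simp add: f_def)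
  hence cf: "card (f ` {..<n}) = n" by (simp add: card_image)
  have "count (f k) 2 \<le> 1" for k by (simp add: f_def)
  moreover have "count N 2 = 2" by (simp add: N_def)
  ultimately have "f k \<noteq> N" for k by (metis one_less_numeral_iff not_le semiring_norm(76))
  hence N: "N \<notin> f ` {..<n}" by blast
  have "insert N (f ` {..<n}) \<subseteq> partitions_of n"
    using assms by (auto simp: partitions_of_def f_def N_def split: if_splits)
  hence "card (insert N (f ` {..<n})) \<le> num_partitions n"
    unfolding num_partitions_def by (intro card_mono finite_partitions_of)
  thus ?thesis using N cf by (simp add: H_def)
qed

lemma H_plus_pos: "m \<in> H_plus \<Longrightarrow> m > 0"
  by (auto simp: H_plus_def H_pos)

lemma finite_I_count: "finite {m \<in> H_plus. real_of_int m \<le> x}"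
proof (rule finite_subset)
  show "{m \<in> H_plus. real_of_int m \<le> x} \<subseteq> {0..\<lfloor>x\<rfloor>}"
    using H_plus_pos by (force simp: le_floor_iff)
qed simp

end

theory Submission
  imports Defs "HOL-Probability.Probability" "HOL-Real_Asymp.Real_Asymp"
begin

text \<open>The theorem is an inversion of the Hardy--Ramanujan formula with a rate,
  \<open>log p(n) = s - 2 log s - log (6 \<surd>3 / \<pi>\<^sup>2) + O(1 / s)\<close> with \<open>s = \<pi> \<surd>(2 n / 3)\<close>.
  For \<open>t = \<pi> / \<surd>(6 n)\<close>, the coefficient integral of \<open>\<Prod> 1 / (1 - z\<^sup>k)\<close> over the circle \<open>|z| = exp (- t)\<close>
  is compared with a Gaussian integral: near the real axis the logarithm of the product is
  expanded to fourth order, the odd terms only entering the real part through their squares, and elsewhere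
  the product is exponentially smaller than at \<open>z = exp (- t)\<close>. The Taylor coefficients are double sums
  over \<open>k\<close> and \<open>m\<close> of \<open>(k m)\<^sup>j exp (- k m t) / m\<close>; those of order 1 and 2 are evaluated by summing over \<open>k\<close>
  first, and the one of order 0 through the product formula for \<open>sinh\<close>.\<close>

subsection \<open>Partition numbers as coefficient integrals\<close>

text \<open>A rate is unavoidable: an error e in log p(n) changes s^2 by about 2 s e after
  inversion, and n = 3 s^2 / (2 pi^2). The bare asymptotic p(n) ~ exp(s) / (4 sqrt 3 n) would
  therefore only give an error o(log x). An error O(1 / s) costs O(1) in n, and the (log log x)^2
  comes from the inversion alone. The constant 6 sqrt 3 / pi^2 is 4 sqrt 3 n / s^2. The choice of t
  makes n equal to pi^2 / (6 t^2), the main term of the first moment. It is not the exact saddle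
  point, so a linear phase of slope O(1 / t) remains. On the Gaussian scale \<theta> ~ t^(3/2) this
  phase is O(sqrt t), as is the cubic one with coefficient O(1 / t^4); their squares and the quartic
  remainder all cost a relative error O(t) = O(1 / s). Only finite products of N \<ge> n factors are
  integrated, which leaves the coefficient of z^n unchanged. N is taken so large that the partial
  moments of order 0, 1 and 2 lie within t of the full ones.\<close>

definition bounded_partitions :: "nat \<Rightarrow> nat \<Rightarrow> nat multiset set" where
  "bounded_partitions N n = {M. set_mset M \<subseteq> {1..N} \<and> sum_mset M = n}"

lemma bounded_partitions_subset: "bounded_partitions N n \<subseteq> partitions_of n"
  by (auto simp: bounded_partitions_def partitions_of_def)

lemma finite_bounded_partitions: "finite (bounded_partitions N n)"
  using bounded_partitions_subset finite_partitions_of by (rule finite_subset)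

lemma bounded_partitions_eq:
  assumes "n \<le> N"
  shows "bounded_partitions N n = partitions_of n"
proof
  show "partitions_of n \<subseteq> bounded_partitions N n"
  proof
    fix M assume M: "M \<in> partitions_of n"
    have "x \<in> {1..N}" if x: "x \<in># M" for x
    proof -
      have "x \<noteq> 0" using M x by (metis (mono_tags, lifting) mem_Collect_eq partitions_of_def)
      moreover have "x \<le> sum_mset M"
        using x by (metis le_add1 multi_member_split sum_mset.add_mset)
      ultimately show ?thesis using M assms by (auto simp: partitions_of_def)
    qed
    thus "M \<in> bounded_partitions N n" using M by (auto simp: bounded_partitions_def partitions_of_def)
  qed
qed (rule bounded_partitions_subset)

lemma card_bounded_partitions_0: "card (bounded_partitions 0 n) = (if n = 0 then 1 else 0)"
proof -
  have "bounded_partitions 0 n = (if n = 0 then {{#}} else {})"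
    by (auto simp: bounded_partitions_def)
  thus ?thesis by simp
qed

text \<open>Partitions are split according to whether the part \<open>Suc N\<close> occurs; if it
  does, removing one copy is a bijection onto the partitions of \<open>n - Suc N\<close> with the
  same bound.\<close>

lemma card_bounded_partitions_Suc:
  "card (bounded_partitions (Suc N) n) = card (bounded_partitions N n) +
     (if Suc N \<le> n then card (bounded_partitions (Suc N) (n - Suc N)) else 0)"
proof -
  define B where "B = {M \<in> bounded_partitions (Suc N) n. Suc N \<in># M}"
  have eq: "bounded_partitions (Suc N) n = bounded_partitions N n \<union> B"
    by (force simp: bounded_partitions_def B_def le_Suc_eq subset_iff)
  have disj: "bounded_partitions N n \<inter> B = {}"
    by (auto simp: bounded_partitions_def B_def subset_iff)
  have B: "B = (if Suc N \<le> n then add_mset (Suc N) ` bounded_partitions (Suc N) (n - Suc N) else {})"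
    (is "_ = ?R")
  proof (intro equalityI subsetI)
    fix M assume M: "M \<in> B"
    then obtain M' where M': "M = add_mset (Suc N) M'"
      by (auto simp: B_def dest: multi_member_split)
    show "M \<in> ?R" using M unfolding M'
      by (auto simp: B_def bounded_partitions_def)
  next
    fix M assume "M \<in> ?R"
    thus "M \<in> B" by (auto simp: B_def bounded_partitions_def split: if_splits)
  qed
  have "finite B" unfolding B_def by (simp add: finite_bounded_partitions)
  hence "card (bounded_partitions (Suc N) n) = card (bounded_partitions N n) + card B"
    unfolding eq using disj by (intro card_Un_disjoint finite_bounded_partitions)
  moreover have "card B = (if Suc N \<le> n then card (bounded_partitions (Suc N) (n - Suc N)) else 0)"
    unfolding B by (simp add: card_image inj_on_def)
  ultimately show ?thesis by simp
qed

text \<open>Adding a part 1 is injective, and n + 1 as well as 2 + (n - 1) are partitions without a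
  part 1. A gain of 2, not only 1, is what makes \<open>H\<close> strictly increasing.\<close>

lemma num_partitions_Suc_ge:
  assumes "n \<ge> 4"
  shows "num_partitions (Suc n) \<ge> num_partitions n + 2"
proof -
  have "card ({{#Suc n#}, {#2, n - 1#}} \<union> add_mset 1 ` partitions_of n)
      = card {{#Suc n#}, {#2, n - 1#}} + card (add_mset 1 ` partitions_of n)"
  proof (rule card_Un_disjoint)
    have "count {#Suc n#} 1 = 0" "count {#2, n - 1#} 1 = 0" using assms by auto
    moreover have "count M 1 \<noteq> 0" if "M \<in> add_mset 1 ` partitions_of n" for M using that by auto
    ultimately show "{{#Suc n#}, {#2, n - 1#}} \<inter> add_mset 1 ` partitions_of n = {}" by blast
  qed (simp_all add: finite_partitions_of)
  moreover have "{#Suc n#} \<noteq> {#2, n - 1#}" by (auto dest: arg_cong[of _ _ size])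
  moreover have "card (add_mset 1 ` partitions_of n) = num_partitions n"
    by (simp add: num_partitions_def card_image inj_on_def)
  moreover have "card ({{#Suc n#}, {#2, n - 1#}} \<union> add_mset 1 ` partitions_of n)
      \<le> num_partitions (Suc n)"
    unfolding num_partitions_def using assms
    by (intro card_mono finite_partitions_of) (auto simp: partitions_of_def)
  ultimately show ?thesis by simp
qed

text \<open>The generating function of partitions with parts at most N, evaluated at z = exp(- (t +
  i \<theta>)) on the circle of radius exp(- t).\<close>

definition partition_prod :: "nat \<Rightarrow> real \<Rightarrow> real \<Rightarrow> complex" where
  "partition_prod N t \<theta> = (\<Prod>k<N. 1 / (1 - exp (- of_nat (Suc k) * Complex t \<theta>)))"

lemma one_minus_exp_nonzero:
  assumes "t > 0"
  shows "1 - exp (- of_nat (Suc k) * Complex t \<theta>) \<noteq> 0"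
proof -
  have "norm (exp (- of_nat (Suc k) * Complex t \<theta>)) < 1"
    using assms by (simp add: norm_exp_eq_Re mult_pos_pos del: of_nat_Suc)
  hence "exp (- of_nat (Suc k) * Complex t \<theta>) \<noteq> 1"
    by (metis less_irrefl norm_one)
  thus ?thesis by (simp del: of_nat_Suc)
qed

lemma continuous_on_Complex [continuous_intros]:
  "continuous_on S f \<Longrightarrow> continuous_on S g \<Longrightarrow> continuous_on S (\<lambda>x. Complex (f x) (g x))"
  unfolding Complex_eq by (intro continuous_intros)

lemma continuous_on_partition_prod [continuous_intros]:
  assumes "t > 0"
  shows "continuous_on S (partition_prod N t)"
  unfolding partition_prod_def
  by (intro continuous_intros ballI one_minus_exp_nonzero assms)

text \<open>Equal to 2 pi times the coefficient of z^n. The index is an integer because the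
  recursion below is followed to negative n, where the coefficient vanishes.\<close>

definition coeff_integral :: "nat \<Rightarrow> real \<Rightarrow> int \<Rightarrow> complex" where
  "coeff_integral N t n = integral {-pi..pi} (\<lambda>\<theta>. partition_prod N t \<theta> * exp (of_int n * Complex t \<theta>))"

lemma coeff_integral_0: "coeff_integral 0 t n = (if n = 0 then 2 * pi else 0)"
proof (cases "n = 0")
  case True
  thus ?thesis by (simp add: coeff_integral_def partition_prod_def scaleR_conv_of_real)
next
  case False
  define F where "F \<theta> = exp (of_int n * Complex t \<theta>) / (of_int n * \<i>)" for \<theta>
  have "((\<lambda>\<theta>. exp (of_int n * Complex t \<theta>)) has_integral F pi - F (-pi)) {-pi..pi}"
  proof (rule fundamental_theorem_of_calculus)
    fix x assume "x \<in> {-pi..pi}"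
    have "((\<lambda>z. exp (of_int n * (of_real t + \<i> * z)) / (of_int n * \<i>))
            has_field_derivative exp (of_int n * (of_real t + \<i> * of_real x))) (at (of_real x))"
      using False by (auto intro!: derivative_eq_intros)
    from has_vector_derivative_real_field[OF this]
    show "(F has_vector_derivative exp (of_int n * Complex t x)) (at x within {-pi..pi})"
      unfolding F_def Complex_eq .
  qed simp
  moreover have "F pi = F (-pi)"
  proof -
    have "exp (of_int n * Complex t pi) = exp (of_int n * Complex t (-pi) + of_int n * (of_real (2 * pi) * \<i>))"
      by (simp add: Complex_eq algebra_simps)
    also have "\<dots> = exp (of_int n * Complex t (-pi))"
      using exp_integer_2pi[of "of_int n"] by (simp add: exp_add mult_ac)
    finally show ?thesis by (simp add: F_def)
  qed
  ultimately show ?thesis using False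
    by (simp add: coeff_integral_def partition_prod_def integral_unique)
qed

text \<open>Multiplication by 1 - z^(N+1) cancels the last factor of the product, and a factor
  z^(N+1) lowers the index by N + 1. This is the recursion of
  \<open>card_bounded_partitions_Suc\<close>.\<close>

lemma coeff_integral_Suc:
  assumes "t > 0"
  shows "coeff_integral (Suc N) t n - coeff_integral (Suc N) t (n - int (Suc N)) = coeff_integral N t n"
proof -
  have "coeff_integral (Suc N) t n - coeff_integral (Suc N) t (n - int (Suc N)) =
     integral {-pi..pi} (\<lambda>\<theta>. partition_prod (Suc N) t \<theta> * exp (of_int n * Complex t \<theta>) -
        partition_prod (Suc N) t \<theta> * exp (of_int (n - int (Suc N)) * Complex t \<theta>))"
    unfolding coeff_integral_def using assms
    by (intro integral_diff[symmetric] integrable_continuous_real continuous_intros) auto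
  also have "(\<lambda>\<theta>. partition_prod (Suc N) t \<theta> * exp (of_int n * Complex t \<theta>) -
        partition_prod (Suc N) t \<theta> * exp (of_int (n - int (Suc N)) * Complex t \<theta>))
      = (\<lambda>\<theta>. partition_prod N t \<theta> * exp (of_int n * Complex t \<theta>))"
  proof
    fix \<theta>
    have "exp (of_int (n - int (Suc N)) * Complex t \<theta>)
        = exp (of_int n * Complex t \<theta>) * exp (- of_nat (Suc N) * Complex t \<theta>)"
      by (simp add: exp_add[symmetric] algebra_simps)
    moreover have "partition_prod (Suc N) t \<theta>
        = partition_prod N t \<theta> / (1 - exp (- of_nat (Suc N) * Complex t \<theta>))"
      by (simp add: partition_prod_def)
    moreover have "a / d * e - a / d * (e * x) = a * e" if "d = 1 - x" "d \<noteq> 0" for a d e x :: complex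
    proof -
      have "a / d * e - a / d * (e * x) = a / d * e * d"
        unfolding that(1) by (simp only: right_diff_distrib mult_1_right mult.assoc)
      thus ?thesis using that(2) by simp
    qed
    ultimately show "partition_prod (Suc N) t \<theta> * exp (of_int n * Complex t \<theta>) -
        partition_prod (Suc N) t \<theta> * exp (of_int (n - int (Suc N)) * Complex t \<theta>)
      = partition_prod N t \<theta> * exp (of_int n * Complex t \<theta>)"
      using one_minus_exp_nonzero[OF assms] by presburger
  qed
  finally show ?thesis by (simp add: coeff_integral_def)
qed

text \<open>The product is bounded on the compact circle, while the exponential factor has modulus
  exp(n t), which decays as n decreases.\<close>

lemma coeff_integral_tendsto_0:
  assumes "t > 0" "p > 0"
  shows "(\<lambda>j. coeff_integral N t (n - int j * int p)) \<longlonglongrightarrow> 0"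
proof -
  have "compact (partition_prod N t ` {-pi..pi})"
    using assms by (intro compact_continuous_image continuous_intros) auto
  then obtain K where K: "norm (partition_prod N t \<theta>) \<le> K" if "\<theta> \<in> {-pi..pi}" for \<theta>
    by (meson bounded_iff compact_imp_bounded image_eqI)
  have "norm (coeff_integral N t m) \<le> K * exp (of_int m * t) * (pi - - pi)" for m
    unfolding coeff_integral_def
  proof (rule integral_bound)
    show "continuous_on {-pi..pi} (\<lambda>\<theta>. partition_prod N t \<theta> * exp (of_int m * Complex t \<theta>))"
      using assms by (intro continuous_intros) auto
    fix x assume x: "x \<in> {-pi..pi}"
    show "norm (partition_prod N t x * exp (of_int m * Complex t x)) \<le> K * exp (of_int m * t)"
      unfolding norm_mult norm_exp_eq_Re using K[OF x] order.trans[OF norm_ge_zero K[OF x]]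
      by (intro mult_mono) auto
  qed simp
  hence b: "norm (coeff_integral N t (n - int j * int p)) \<le> K * exp (of_int (n - int j * int p) * t) * (2 * pi)" for j
    by (metis (no_types, lifting) diff_minus_eq_add mult_2)
  have "filterlim (\<lambda>j. t * real p * real j) at_top sequentially"
    by (rule filterlim_tendsto_pos_mult_at_top[OF tendsto_const _ filterlim_real_sequentially])
      (use assms in simp)
  hence "(\<lambda>j. exp (- (t * real p * real j))) \<longlonglongrightarrow> 0"
    by (intro filterlim_compose[OF exp_at_bot] filterlim_compose[OF filterlim_uminus_at_bot_at_top])
  hence "(\<lambda>j. K * exp (n * t) * (2 * pi) * exp (- (t * real p * real j))) \<longlonglongrightarrow> 0"
    by (rule tendsto_mult_right_zero)
  also have "(\<lambda>j. K * exp (n * t) * (2 * pi) * exp (- (t * real p * real j)))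
     = (\<lambda>j. K * exp (of_int (n - int j * int p) * t) * (2 * pi))"
    by (auto simp: exp_diff exp_minus field_simps fun_eq_iff left_diff_distrib simp flip: exp_add)
  finally show ?thesis
    by (rule Lim_null_comparison[rotated]) (use b in auto)
qed

text \<open>No contour deformation is needed: the difference of the two sides is periodic in \<open>n\<close> with
  period \<open>Suc N\<close> and tends to 0 as \<open>n\<close> tends to \<open>-\<infinity>\<close>.\<close>

lemma coeff_integral_eq:
  assumes t: "t > 0"
  shows "coeff_integral N t n = (if n < 0 then 0 else 2 * pi * real (card (bounded_partitions N (nat n))))"
proof (induction N arbitrary: n)
  case 0
  show ?case by (auto simp: coeff_integral_0 card_bounded_partitions_0)
next
  case (Suc N)
  define a where "a N n = (if n < 0 then 0 else 2 * pi * real (card (bounded_partitions N (nat n))))"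
    for N and n :: int
  define d where "d n = coeff_integral (Suc N) t n - a (Suc N) n" for n
  have a: "a (Suc N) n - a (Suc N) (n - int (Suc N)) = a N n" for n
  proof (cases "n \<ge> int (Suc N)")
    case True
    moreover have "nat (n - int (Suc N)) = nat n - Suc N" by linarith
    moreover have "Suc N \<le> nat n" using True by linarith
    ultimately show ?thesis
      using card_bounded_partitions_Suc[of N "nat n"] by (simp add: a_def algebra_simps)
  next
    case False
    thus ?thesis
      using card_bounded_partitions_Suc[of N "nat n"] by (auto simp: a_def)
  qed
  have period: "d (n - int (Suc N)) = d n" for n
    using coeff_integral_Suc[OF t, of N n] Suc.IH[of n] a[of n]
    by (simp add: d_def a_def[of N] algebra_simps)
  have const: "d (n - int j * int (Suc N)) = d n" for n j
  proof (induction j)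
    case (Suc j)
    have "n - int (Suc j) * int (Suc N) = n - int j * int (Suc N) - int (Suc N)"
      by (simp add: algebra_simps)
    thus ?case using Suc period[of "n - int j * int (Suc N)"] by metis
  qed simp
  have "(\<lambda>j. coeff_integral (Suc N) t (n - int j * int (Suc N))) \<longlonglongrightarrow> 0"
    by (rule coeff_integral_tendsto_0[OF t]) simp
  moreover have "eventually (\<lambda>j. coeff_integral (Suc N) t (n - int j * int (Suc N)) = d n) sequentially"
    using eventually_gt_at_top[of "nat n"]
  proof eventually_elim
    case (elim j)
    have "int j \<le> int j * int (Suc N)" by (simp add: algebra_simps)
    hence "n - int j * int (Suc N) < 0" using elim by linarith
    thus ?case using const[of n j] by (simp add: d_def a_def)
  qed
  ultimately have "(\<lambda>j. d n) \<longlonglongrightarrow> 0" by (rule Lim_transform_eventually)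
  hence "d n = 0" by (simp add: LIMSEQ_const_iff)
  thus ?case by (simp add: d_def a_def)
qed

lemma num_partitions_integral:
  assumes "t > 0" "n \<le> N"
  shows "integral {-pi..pi} (\<lambda>\<theta>. partition_prod N t \<theta> * exp (of_nat n * Complex t \<theta>)) =
         of_real (2 * pi * real (num_partitions n))"
  using coeff_integral_eq[OF assms(1), of N "int n"] assms(2)
  by (simp add: coeff_integral_def num_partitions_def bounded_partitions_eq)

subsection \<open>Moments\<close>

text \<open>Tonelli's theorem for nonnegative double series: both iterated sums equal the unordered
  sum over all pairs.\<close>

lemma double_suminf_swap:
  fixes a :: "nat \<Rightarrow> nat \<Rightarrow> real"
  assumes nonneg: "\<And>k m. a k m \<ge> 0"
    and rows: "\<And>k. summable (a k)" and total: "summable (\<lambda>k. \<Sum>m. a k m)"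
  shows "summable (\<lambda>k. a k m)"
    and "(\<lambda>m. \<Sum>k. a k m) sums (\<Sum>k. \<Sum>m. a k m)"
proof -
  have le: "a k m \<le> (\<Sum>m. a k m)" for k m
    using sum_le_suminf[OF rows, of "{m}"] nonneg by simp
  show cols: "summable (\<lambda>k. a k m)" for m
    by (rule summable_comparison_test'[OF total]) (use le nonneg in auto)
  have hs: "((\<lambda>n. f n) has_sum suminf f) UNIV" if "summable f" "\<And>n. f n \<ge> 0" for f :: "nat \<Rightarrow> real"
    using that by (intro norm_summable_imp_has_sum) (auto simp: summable_sums)
  have tot_nonneg: "(\<Sum>m. a k m) \<ge> 0" for k using nonneg rows by (intro suminf_nonneg) auto
  have sm: "(\<lambda>(k, m). a k m) summable_on UNIV \<times> UNIV"
    by (rule summable_on_SigmaI[where g = "\<lambda>k. \<Sum>m. a k m"])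
      (use hs rows nonneg total tot_nonneg in \<open>auto simp: summable_on_UNIV_nonneg_real_iff\<close>)
  then obtain S where S: "((\<lambda>(k, m). a k m) has_sum S) (UNIV \<times> UNIV)"
    by (auto simp: summable_on_def)
  have "((\<lambda>k. \<Sum>m. a k m) has_sum S) UNIV"
    by (rule has_sum_SigmaD[OF S]) (use hs rows nonneg in auto)
  hence "(\<Sum>k. \<Sum>m. a k m) = S" by (auto dest!: has_sum_imp_sums simp: sums_iff)
  moreover have "((\<lambda>(m, k). a k m) has_sum S) (UNIV \<times> UNIV)"
    using S by (subst has_sum_swap) auto
  hence "((\<lambda>m. \<Sum>k. a k m) has_sum S) UNIV"
    by (rule has_sum_SigmaD) (use hs cols nonneg in auto)
  ultimately show "(\<lambda>m. \<Sum>k. a k m) sums (\<Sum>k. \<Sum>m. a k m)" by (auto dest: has_sum_imp_sums)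
qed

lemma geometric_exp_sums:
  fixes y :: real
  assumes "y > 0"
  shows "(\<lambda>k. exp (- y * real (Suc k))) sums (1 / (exp y - 1))"
proof -
  have "(\<lambda>k. exp (-y) * exp (-y) ^ k) sums (exp (-y) * (1 / (1 - exp (-y))))"
    using assms by (intro sums_mult geometric_sums) auto
  also have "(\<lambda>k. exp (-y) * exp (-y) ^ k) = (\<lambda>k. exp (- y * real (Suc k)))"
    by (auto simp: fun_eq_iff exp_of_nat_mult[symmetric] mult_ac simp flip: exp_add)
      (simp add: algebra_simps)
  also have "exp (-y) * (1 / (1 - exp (-y))) = 1 / (exp y - 1)"
    using assms by (simp add: exp_minus field_simps)
  finally show ?thesis .
qed

lemma power_le_fact_exp:
  fixes x :: real
  assumes "x \<ge> 0"
  shows "x ^ j \<le> fact j * exp x"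
proof -
  have "x ^ j /\<^sub>R fact j \<le> exp x"
    unfolding exp_def using sum_le_suminf[OF summable_exp_generic[of x], of "{j}"] assms by simp
  thus ?thesis by (simp add: field_simps)
qed

text \<open>The j-th derivative of 1 / (exp y - 1) up to the sign (-1)^j, as a series over n = k + 1
  \<ge> 1.\<close>

definition exp_moment :: "nat \<Rightarrow> real \<Rightarrow> real" where
  "exp_moment j y = (\<Sum>k. real (Suc k) ^ j * exp (- y * real (Suc k)))"

text \<open>Half of the exponential absorbs the power, since (y n / 2)^j \<le> j! exp(y n / 2) for n
  = k + 1. The other half leaves a geometric series with sum at most 2 / y, which accounts for the
  powers of 2.\<close>

lemma
  fixes y :: real
  assumes y: "y > 0"
  shows summable_exp_moment: "summable (\<lambda>k. real (Suc k) ^ j * exp (- y * real (Suc k)))"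
    and exp_moment_nonneg: "exp_moment j y \<ge> 0"
    and exp_moment_le: "exp_moment j y \<le> fact j * 2 ^ Suc j / y ^ Suc j"
proof -
  have le: "real (Suc k) ^ j * exp (- y * real (Suc k)) \<le>
            fact j * (2 / y) ^ j * exp (- (y / 2) * real (Suc k))" for k
  proof -
    have "(y / 2 * real (Suc k)) ^ j \<le> fact j * exp (y / 2 * real (Suc k))"
      using y by (intro power_le_fact_exp) auto
    hence "(2 / y) ^ j * (y / 2 * real (Suc k)) ^ j * exp (- y * real (Suc k))
      \<le> (2 / y) ^ j * (fact j * exp (y / 2 * real (Suc k))) * exp (- y * real (Suc k))"
      using y by (intro mult_left_mono mult_right_mono) auto
    also have "(2 / y) ^ j * (y / 2 * real (Suc k)) ^ j = real (Suc k) ^ j"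
      using y by (simp del: of_nat_Suc flip: power_mult_distrib)
    also have "(2 / y) ^ j * (fact j * exp (y / 2 * real (Suc k))) * exp (- y * real (Suc k))
       = fact j * (2 / y) ^ j * (exp (y / 2 * real (Suc k)) * exp (- y * real (Suc k)))"
      by (simp only: mult_ac)
    also have "exp (y / 2 * real (Suc k)) * exp (- y * real (Suc k)) = exp (- (y / 2) * real (Suc k))"
      unfolding exp_add[symmetric] by (rule arg_cong[of _ _ exp]) (simp add: field_simps)
    finally show ?thesis .
  qed
  have s: "(\<lambda>k. fact j * (2 / y) ^ j * exp (- (y / 2) * real (Suc k))) sums
          (fact j * (2 / y) ^ j * (1 / (exp (y / 2) - 1)))"
    using y by (intro sums_mult geometric_exp_sums) auto
  show sm: "summable (\<lambda>k. real (Suc k) ^ j * exp (- y * real (Suc k)))"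
    by (rule summable_comparison_test'[OF sums_summable[OF s]]) (use le in auto)
  show "exp_moment j y \<ge> 0" unfolding exp_moment_def by (rule suminf_nonneg[OF sm]) auto
  have "exp_moment j y \<le> (\<Sum>k. fact j * (2 / y) ^ j * exp (- (y / 2) * real (Suc k)))"
    unfolding exp_moment_def by (rule suminf_le[OF le sm sums_summable[OF s]])
  also have "\<dots> = fact j * (2 / y) ^ j * (1 / (exp (y / 2) - 1))" using s by (simp add: sums_iff)
  also have "y / 2 \<le> exp (y / 2) - 1" using exp_ge_add_one_self[of "y / 2"] by linarith
  hence "fact j * (2 / y) ^ j * (1 / (exp (y / 2) - 1)) \<le> fact j * (2 / y) ^ j * (1 / (y / 2))"
    using y by (intro mult_left_mono divide_left_mono) auto
  also have "\<dots> = fact j * 2 ^ Suc j / y ^ Suc j" by (simp add: power_divide mult_ac)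
  finally show "exp_moment j y \<le> fact j * 2 ^ Suc j / y ^ Suc j" .
qed

text \<open>The moment of order \<open>j\<close> is \<open>(- d/dt)\<^sup>j\<close> of \<open>log \<Prod> 1 / (1 - exp (- k t))\<close>, written as a double sum
  over \<open>k\<close> and \<open>m\<close> (both shifted by one) after expanding the logarithm.\<close>

definition moment_term :: "nat \<Rightarrow> real \<Rightarrow> nat \<Rightarrow> nat \<Rightarrow> real" where
  "moment_term j t k m = (real (Suc k) * real (Suc m)) ^ j / real (Suc m) * exp (- t * (real (Suc k) * real (Suc m)))"

definition moment_row :: "nat \<Rightarrow> real \<Rightarrow> nat \<Rightarrow> real" where
  "moment_row j t k = (\<Sum>m. moment_term j t k m)"

definition moment :: "nat \<Rightarrow> real \<Rightarrow> real" where
  "moment j t = (\<Sum>k. moment_row j t k)"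

text \<open>The terms of fixed m summed over k. There m enters only through a prefactor and the
  argument of \<open>exp_moment\<close>, so estimates of \<open>exp_moment\<close> carry over to
  \<open>moment\<close> column by column.\<close>

definition moment_column :: "nat \<Rightarrow> real \<Rightarrow> nat \<Rightarrow> real" where
  "moment_column j t m = real (Suc m) ^ j / real (Suc m) * exp_moment j (t * real (Suc m))"

lemma moment_term_nonneg: "moment_term j t k m \<ge> 0"
  by (simp add: moment_term_def)

lemma summable_inverse_squares: "summable (\<lambda>m. 1 / real (Suc m) ^ 2)"
  using inverse_squares_sums by (simp add: sums_iff add_ac)

lemma suminf_inverse_squares: "(\<Sum>m. 1 / real (Suc m) ^ 2) = pi\<^sup>2 / 6"
  using inverse_squares_sums by (simp add: sums_iff add_ac)

text \<open>With M = m + 1, the prefactor M^(j-1) meets the bound of order M^(-j-1) from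
  \<open>exp_moment_le\<close>, so that for every j the columns decay like 1 / M^2. This gives
  convergence in column order, and the interchange carries it over to the rows.\<close>

lemma
  assumes t: "t > 0"
  shows summable_moment_term: "summable (moment_term j t k)"
    and summable_moment_row: "summable (moment_row j t)"
    and moment_column_sums: "moment_column j t sums moment j t"
    and moment_le: "moment j t \<le> fact j * 2 ^ Suc j * (pi\<^sup>2 / 6) / t ^ Suc j"
proof -
  have eq: "moment_term j t k m = real (Suc m) ^ j / real (Suc m) *
      (real (Suc k) ^ j * exp (- (t * real (Suc m)) * real (Suc k)))" for k m
    by (simp add: moment_term_def power_mult_distrib mult_ac del: of_nat_Suc)
  have sum_col: "summable (\<lambda>k. moment_term j t k m)" for m
    unfolding eq using t by (intro summable_mult summable_exp_moment) auto
  have col: "(\<Sum>k. moment_term j t k m) = moment_column j t m" for m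
    unfolding eq moment_column_def exp_moment_def
    using t by (intro suminf_mult summable_exp_moment) auto
  define C where "C = fact j * 2 ^ Suc j / t ^ Suc j"
  have le: "moment_column j t m \<le> C * (1 / real (Suc m) ^ 2)" for m
  proof -
    have "moment_column j t m \<le>
        real (Suc m) ^ j / real (Suc m) * (fact j * 2 ^ Suc j / (t * real (Suc m)) ^ Suc j)"
      unfolding moment_column_def using t by (intro mult_left_mono exp_moment_le) auto
    also have "\<dots> = C * (1 / real (Suc m) ^ 2)"
      using t by (simp add: C_def power_mult_distrib power2_eq_square field_simps del: of_nat_Suc)
    finally show ?thesis .
  qed
  have nonneg: "moment_column j t m \<ge> 0" for m
    unfolding moment_column_def using t by (intro mult_nonneg_nonneg exp_moment_nonneg) auto
  have sC: "summable (\<lambda>m. C * (1 / real (Suc m) ^ 2))"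
    by (intro summable_mult summable_inverse_squares)
  have sm: "summable (moment_column j t)"
    by (rule summable_comparison_test'[OF sC]) (use le nonneg in auto)
  have sm': "summable (\<lambda>m. \<Sum>k. moment_term j t k m)" using sm by (simp add: col)
  note swap = double_suminf_swap[OF moment_term_nonneg sum_col sm']
  show "summable (moment_term j t k)" by (rule swap(1))
  have rows: "moment_row j t sums (\<Sum>m. moment_column j t m)"
    using swap(2) by (simp add: moment_row_def[abs_def] col)
  thus "summable (moment_row j t)" by (simp add: sums_iff)
  show *: "moment_column j t sums moment j t"
    using rows sm by (simp add: moment_def sums_iff)
  have "moment j t = (\<Sum>m. moment_column j t m)" using * by (simp add: sums_iff)
  also have "\<dots> \<le> (\<Sum>m. C * (1 / real (Suc m) ^ 2))" by (rule suminf_le[OF le sm sC])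
  also have "\<dots> = C * (pi\<^sup>2 / 6)"
    by (simp only: suminf_mult[OF summable_inverse_squares] suminf_inverse_squares)
  finally show "moment j t \<le> fact j * 2 ^ Suc j * (pi\<^sup>2 / 6) / t ^ Suc j" by (simp add: C_def)
qed

lemma moment_row_nonneg: "t > 0 \<Longrightarrow> moment_row j t k \<ge> 0"
  unfolding moment_row_def by (intro suminf_nonneg summable_moment_term moment_term_nonneg)

section \<open>Closed forms for the exponential sums\<close>

lemma exp_moment_0: "y > 0 \<Longrightarrow> exp_moment 0 y = 1 / (exp y - 1)"
  using geometric_exp_sums[of y] by (simp add: exp_moment_def sums_iff)

text \<open>Summation by parts: multiplying by 1 - exp(- y) replaces the coefficients by their
  differences, which lowers the degree of a polynomial coefficient by one.\<close>

lemma suminf_exp_difference: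
  fixes y :: real and c d :: "nat \<Rightarrow> real"
  assumes "summable (\<lambda>k. c (Suc k) * exp (- y * real (Suc k)))" "c 0 = 0"
    and "\<And>k. d k = c (Suc k) - c k"
  shows "(\<Sum>k. d k * exp (- y * real (Suc k))) = (1 - exp (-y)) * (\<Sum>k. c (Suc k) * exp (- y * real (Suc k)))"
proof -
  have "summable (\<lambda>k. c k * exp (- y * real k))"
    using assms(1) by (subst summable_Suc_iff[symmetric]) simp
  hence "(\<lambda>k. c k * exp (- y * real k)) sums (\<Sum>k. c (Suc k) * exp (- y * real (Suc k)))"
    using suminf_split_head[of "\<lambda>k. c k * exp (- y * real k)"] assms(2) by (simp add: sums_iff)
  from sums_diff[OF summable_sums[OF assms(1)] sums_mult[OF this, of "exp (-y)"]]
  have "(\<lambda>k. c (Suc k) * exp (- y * real (Suc k)) - exp (-y) * (c k * exp (- y * real k)))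
     sums ((1 - exp (-y)) * (\<Sum>k. c (Suc k) * exp (- y * real (Suc k))))"
    by (simp add: algebra_simps)
  moreover have "exp (-y) * exp (- y * real k) = exp (- y * real (Suc k))" for k
    by (simp add: algebra_simps flip: exp_add)
  hence "exp (-y) * (c k * exp (- y * real k)) = c k * exp (- y * real (Suc k))" for k
    by (metis mult.left_commute)
  hence "(\<lambda>k. c (Suc k) * exp (- y * real (Suc k)) - exp (-y) * (c k * exp (- y * real k)))
      = (\<lambda>k. d k * exp (- y * real (Suc k)))"
    by (simp only: assms(3) left_diff_distrib)
  ultimately show ?thesis by (simp only: sums_iff)
qed

lemma exp_diff_sinh:
  fixes y :: real
  shows "1 - exp (-y) = 2 * exp (- y / 2) * sinh (y / 2)" "1 + exp (-y) = 2 * exp (- y / 2) * cosh (y / 2)"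
  by (simp_all add: sinh_field_def cosh_field_def algebra_simps flip: exp_add)

lemma exp_moment_1:
  assumes y: "y > 0"
  shows "exp_moment 1 y = 1 / (4 * sinh (y / 2) ^ 2)"
proof -
  have "(1 - exp (-y)) * exp_moment 1 y = exp_moment 0 y"
    using suminf_exp_difference[of real y "\<lambda>_. 1"] summable_exp_moment[OF y, of 1]
    by (simp add: exp_moment_def)
  also have "\<dots> = exp (-y) / (1 - exp (-y))"
    using y by (simp add: exp_moment_0 exp_minus field_simps)
  also have "\<dots> = exp (- y / 2) / (2 * sinh (y / 2))"
    unfolding exp_diff_sinh using y by (simp add: field_simps flip: exp_add)
  finally show ?thesis
    unfolding exp_diff_sinh using y by (simp add: field_simps power2_eq_square)
qed

text \<open>The differences of n^2 are 2 n - 1, which leads back to orders 1 and 0. The sum of order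
  0 is in turn 1 - exp(- y) times that of order 1, whence the factor 1 + exp(- y) and the hyperbolic
  cosine.\<close>

lemma exp_moment_2:
  assumes y: "y > 0"
  shows "exp_moment 2 y = cosh (y / 2) / (4 * sinh (y / 2) ^ 3)"
proof -
  have "(1 - exp (-y)) * exp_moment 2 y = (\<Sum>k. (2 * real (Suc k) - 1) * exp (- y * real (Suc k)))"
    using suminf_exp_difference[of "\<lambda>k. real k ^ 2" y "\<lambda>k. 2 * real (Suc k) - 1"] summable_exp_moment[OF y, of 2]
    by (simp add: exp_moment_def power2_eq_square algebra_simps)
  also have "\<dots> = 2 * exp_moment 1 y - exp_moment 0 y"
    using sums_diff[OF sums_mult[OF summable_sums[OF summable_exp_moment[OF y, of 1]], of 2]
      summable_sums[OF summable_exp_moment[OF y, of 0]]]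
    by (simp add: exp_moment_def sums_iff algebra_simps)
  also have "exp_moment 0 y = (1 - exp (-y)) * exp_moment 1 y"
    using suminf_exp_difference[of real y "\<lambda>_. 1"] summable_exp_moment[OF y, of 1]
    by (simp add: exp_moment_def)
  also have "2 * exp_moment 1 y - (1 - exp (-y)) * exp_moment 1 y = (1 + exp (-y)) * exp_moment 1 y"
    by (simp add: algebra_simps)
  finally show ?thesis
    unfolding exp_diff_sinh exp_moment_1[OF y] using y by (simp add: field_simps power2_eq_square power3_eq_cube)
qed


text \<open>A Riemann sum for the integral of 1 / (1 + x)^2 over the positive axis, which is 1; the
  comparison is made with the telescoping differences of - 1 / (t (1 + t m)).\<close>

lemma telescope_inverse_square:
  assumes t: "t > 0"
  shows "summable (\<lambda>m. 1 / (1 + t * real (Suc m)) ^ 2)"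
    and "(\<Sum>m. 1 / (1 + t * real (Suc m)) ^ 2) \<le> 1 / t"
proof -
  define g where "g m = - (1 / t) * (1 / (1 + t * real m))" for m
  have "g \<longlonglongrightarrow> - (1 / t) * 0"
    unfolding g_def using t by (intro tendsto_mult tendsto_const) real_asymp
  hence s: "(\<lambda>m. g (Suc m) - g m) sums (0 - g 0)" by (intro telescope_sums) simp
  have le: "1 / (1 + t * real (Suc m)) ^ 2 \<le> g (Suc m) - g m" for m
  proof -
    define a where "a = 1 + t * real m"
    have a: "a > 0" using t by (simp add: a_def add_pos_nonneg)
    have "1 / (a + t) ^ 2 \<le> 1 / (a * (a + t))"
      using a t by (intro divide_left_mono) (auto simp: power2_eq_square)
    also have "\<dots> = - (1 / t) * (1 / (a + t)) - - (1 / t) * (1 / a)"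
      using a t by (simp add: divide_simps)
    finally show ?thesis by (simp add: g_def a_def algebra_simps)
  qed
  show sm: "summable (\<lambda>m. 1 / (1 + t * real (Suc m)) ^ 2)"
    by (rule summable_comparison_test'[OF sums_summable[OF s]]) (use le in auto)
  show "(\<Sum>m. 1 / (1 + t * real (Suc m)) ^ 2) \<le> 1 / t"
    using suminf_le[OF le sm sums_summable[OF s]] s t by (simp add: sums_iff g_def)
qed

text \<open>This is how all estimates in y = t (m + 1) are summed: an error of size C / (1 + y)^2 in
  each term costs only C / t in total, however many terms there are.\<close>

lemma sums_approx:
  fixes a b :: "nat \<Rightarrow> real"
  assumes "a sums A" "b sums B" "\<And>m. \<bar>a m - b m\<bar> \<le> C * (1 / (1 + t * real (Suc m)) ^ 2)" "t > 0" "C \<ge> 0"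
  shows "\<bar>A - B\<bar> \<le> C / t"
proof -
  have sC: "summable (\<lambda>m. C * (1 / (1 + t * real (Suc m)) ^ 2))"
    by (intro summable_mult telescope_inverse_square assms)
  have "A - B = (\<Sum>m. a m - b m)" using sums_diff[OF assms(1,2)] by (simp add: sums_iff)
  also have "\<bar>\<dots>\<bar> \<le> (\<Sum>m. C * (1 / (1 + t * real (Suc m)) ^ 2))"
    using norm_suminf_le[OF _ sC, of "\<lambda>m. a m - b m"] assms(3) by simp
  also have "\<dots> = C * (\<Sum>m. 1 / (1 + t * real (Suc m)) ^ 2)"
    by (intro suminf_mult telescope_inverse_square assms)
  also have "\<dots> \<le> C * (1 / t)"
    by (intro mult_left_mono telescope_inverse_square assms)
  finally show ?thesis by simp
qed

section \<open>Hyperbolic inequalities and the moments of order 1 and 2\<close>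

lemma sinh_le_mult_cosh:
  fixes z :: real
  assumes "z \<ge> 0"
  shows "sinh z \<le> z * cosh z"
proof -
  have "(\<lambda>z. z * cosh z - sinh z) 0 \<le> (\<lambda>z. z * cosh z - sinh z) z"
    using assms
    by (rule DERIV_nonneg_imp_nondecreasing)
      (auto intro!: derivative_eq_intros exI mult_nonneg_nonneg simp: algebra_simps)
  thus ?thesis by simp
qed

text \<open>Together with \<open>sinh_le_mult_cosh\<close> this places coth z between 1 / z and 1 /
  z + z for z > 0, which isolates the poles of the closed forms.\<close>

lemma mult_cosh_le:
  fixes z :: real
  assumes "z \<ge> 0"
  shows "z * cosh z \<le> (1 + z\<^sup>2) * sinh z"
proof -
  have "(\<lambda>z. (1 + z\<^sup>2) * sinh z - z * cosh z) 0 \<le> (\<lambda>z. (1 + z\<^sup>2) * sinh z - z * cosh z) z"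
    using assms
  proof (rule DERIV_nonneg_imp_nondecreasing)
    fix x :: real assume x: "0 \<le> x" "x \<le> z"
    have "((\<lambda>z. (1 + z\<^sup>2) * sinh z - z * cosh z) has_real_derivative x * sinh x + x\<^sup>2 * cosh x) (at x)"
      by (auto intro!: derivative_eq_intros simp: algebra_simps power2_eq_square)
    moreover have "x * sinh x + x\<^sup>2 * cosh x \<ge> 0" using x by simp
    ultimately show "\<exists>y. ((\<lambda>z. (1 + z\<^sup>2) * sinh z - z * cosh z) has_real_derivative y) (at x) \<and> 0 \<le> y"
      by blast
  qed
  thus ?thesis by simp
qed

text \<open>The defect D = 1 / y^2 - \<open>exp_moment 1 y\<close> is nonnegative, at most 1 / 4
  (useful for small y) and at most 1 / y^2 (useful for large y). The inequality (1 + y)^2 \<le> 2 +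
  2 y^2 merges the two bounds.\<close>

lemma exp_moment_1_approx:
  assumes y: "y > 0"
  shows "\<bar>exp_moment 1 y - 1 / y ^ 2\<bar> \<le> 4 / (1 + y) ^ 2"
proof -
  define z where "z = y / 2"
  have z: "z > 0" "sinh z > 0" and yz: "y = 2 * z" using y by (auto simp: z_def)
  have "z \<le> sinh z" using real_le_x_sinh[of z] z by (simp add: sinh_field_def exp_minus)
  hence le: "z\<^sup>2 \<le> sinh z ^ 2" using z by (intro power_mono) auto
  have "sinh z ^ 2 \<le> (z * cosh z) ^ 2" using z sinh_le_mult_cosh[of z] by (intro power_mono) auto
  also have "\<dots> = z\<^sup>2 * (sinh z ^ 2 + 1)" by (simp add: power_mult_distrib cosh_square_eq)
  finally have le': "sinh z ^ 2 - z\<^sup>2 \<le> z\<^sup>2 * sinh z ^ 2" by (simp add: algebra_simps)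
  define D where "D = 1 / y ^ 2 - exp_moment 1 y"
  have D: "D = (sinh z ^ 2 - z\<^sup>2) / (4 * (z\<^sup>2 * sinh z ^ 2))"
    unfolding D_def exp_moment_1[OF y] z_def[symmetric] using z by (simp add: yz field_simps)
  have 1: "D \<le> 1 / 4" unfolding D using le' z by (simp add: divide_le_eq)
  have 2: "D \<le> 1 / y\<^sup>2" unfolding D_def using exp_moment_nonneg[OF y, of 1] by simp
  have 0: "D \<ge> 0" unfolding D using le z by simp
  have "(1 + y)\<^sup>2 \<le> 2 + 2 * y\<^sup>2" using zero_le_square[of "1 - y"] by (simp add: power2_eq_square algebra_simps)
  hence "D * (1 + y)\<^sup>2 \<le> D * (2 + 2 * y\<^sup>2)" using 0 by (intro mult_left_mono)
  also have "\<dots> \<le> 4" using 1 2 y by (simp add: field_simps)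
  finally have "D \<le> 4 / (1 + y)\<^sup>2" using y by (simp add: field_simps)
  thus ?thesis using 0 by (simp add: D_def)
qed

text \<open>The bound 1 / (2 y) from the hyperbolic inequalities and the crude bound 16 / y^3 are
  merged as in order 1, giving 2 * 1/2 + 2 * 16 = 33. The extra factor 1 / y compensates the
  prefactor m + 1 of the column of order 2.\<close>

lemma exp_moment_2_approx:
  assumes y: "y > 0"
  shows "\<bar>exp_moment 2 y - 2 / y ^ 3\<bar> \<le> 33 / (y * (1 + y) ^ 2)"
proof -
  define z where "z = y / 2"
  have z: "z > 0" "sinh z > 0" "cosh z > 0" and yz: "y = 2 * z" using y by (auto simp: z_def)
  have "z \<le> sinh z" using real_le_x_sinh[of z] z by (simp add: sinh_field_def exp_minus)
  hence le: "z\<^sup>2 \<le> sinh z ^ 2" using z by (intro power_mono) auto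
  have "sinh z ^ 2 \<le> (z * cosh z) ^ 2" using z sinh_le_mult_cosh[of z] by (intro power_mono) auto
  also have "\<dots> = z\<^sup>2 * (sinh z ^ 2 + 1)" by (simp add: power_mult_distrib cosh_square_eq)
  finally have le': "sinh z ^ 2 * (1 - z\<^sup>2) \<le> z\<^sup>2" by (simp add: algebra_simps)
  define c where "c = cosh z / sinh z ^ 3"
  have c: "c = cosh z / sinh z * (1 / sinh z ^ 2)" by (simp add: c_def power2_eq_square power3_eq_cube)
  have "c \<le> (1 + z\<^sup>2) / z * (1 / z\<^sup>2)"
    unfolding c using z le mult_cosh_le[of z]
    by (intro mult_mono divide_left_mono) (auto simp: field_simps)
  hence up: "c \<le> 1 / z ^ 3 + 1 / z" using z by (simp add: field_simps power2_eq_square power3_eq_cube)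
  have "1 / z * (1 / z\<^sup>2 - 1) \<le> 1 / z * (1 / sinh z ^ 2)"
    using le' z by (intro mult_left_mono) (auto simp: field_simps)
  also have "\<dots> \<le> c" unfolding c using z sinh_le_mult_cosh[of z]
    by (intro mult_right_mono) (auto simp: field_simps)
  finally have lo: "c \<ge> 1 / z ^ 3 - 1 / z" using z by (simp add: field_simps power2_eq_square power3_eq_cube)
  define D where "D = \<bar>exp_moment 2 y - 2 / y ^ 3\<bar>"
  have "exp_moment 2 y - 2 / y ^ 3 = (c - 1 / z ^ 3) / 4"
    unfolding exp_moment_2[OF y] using z by (simp add: yz c_def field_simps)
  hence D1: "D \<le> 1 / (2 * y)" unfolding D_def using up lo by (simp add: yz field_simps)
  have "exp_moment 2 y \<le> 16 / y ^ 3" using exp_moment_le[OF y, of 2] by (simp add: eval_nat_numeral)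
  moreover have "2 / y ^ 3 \<le> 16 / y ^ 3" "2 / y ^ 3 \<ge> 0" using y by (auto intro!: divide_right_mono)
  ultimately have D2: "D \<le> 16 / y ^ 3"
    using exp_moment_nonneg[OF y, of 2] unfolding D_def abs_le_iff by linarith
  have "(1 + y)\<^sup>2 \<le> 2 + 2 * y\<^sup>2" using zero_le_square[of "1 - y"] by (simp add: power2_eq_square algebra_simps)
  hence "D * (y * (1 + y)\<^sup>2) \<le> D * (y * (2 + 2 * y\<^sup>2))" using y by (intro mult_left_mono) (auto simp: D_def)
  also have "\<dots> = 2 * (D * y) + 2 * (D * y ^ 3)" by (simp add: algebra_simps power2_eq_square power3_eq_cube)
  also have "\<dots> \<le> 33" using D1 D2 y by (simp add: field_simps)
  finally show ?thesis using y by (simp add: field_simps D_def)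
qed

lemma moment_1_approx:
  assumes t: "t > 0"
  shows "\<bar>moment 1 t - pi\<^sup>2 / (6 * t\<^sup>2)\<bar> \<le> 4 / t"
proof (rule sums_approx[OF moment_column_sums[OF t]])
  show "(\<lambda>m. 1 / t\<^sup>2 * (1 / real (Suc m) ^ 2)) sums (pi\<^sup>2 / (6 * t\<^sup>2))"
    using sums_mult[OF summable_sums[OF summable_inverse_squares], of "1 / t\<^sup>2"]
    unfolding suminf_inverse_squares by (simp add: mult_ac)
  fix m
  show "\<bar>moment_column 1 t m - 1 / t\<^sup>2 * (1 / real (Suc m) ^ 2)\<bar> \<le> 4 * (1 / (1 + t * real (Suc m))\<^sup>2)"
    using exp_moment_1_approx[of "t * real (Suc m)"] t
    by (simp add: moment_column_def power_mult_distrib mult_ac del: of_nat_Suc)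
qed (use t in auto)

lemma moment_2_approx:
  assumes t: "t > 0"
  shows "\<bar>moment 2 t - pi\<^sup>2 / (3 * t ^ 3)\<bar> \<le> 33 / t\<^sup>2"
proof -
  have "\<bar>moment 2 t - pi\<^sup>2 / (3 * t ^ 3)\<bar> \<le> (33 / t) / t"
  proof (rule sums_approx[OF moment_column_sums[OF t]])
    show "(\<lambda>m. 2 / t ^ 3 * (1 / real (Suc m) ^ 2)) sums (pi\<^sup>2 / (3 * t ^ 3))"
      using sums_mult[OF summable_sums[OF summable_inverse_squares], of "2 / t ^ 3"]
      unfolding suminf_inverse_squares by (simp add: mult_ac)
    fix m
    define M where "M = real (Suc m)"
    have M: "M > 0" by (simp add: M_def)
    have "moment_column 2 t m - 2 / t ^ 3 * (1 / M ^ 2) = M * (exp_moment 2 (t * M) - 2 / (t * M) ^ 3)"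
    proof -
      have "moment_column 2 t m = M * exp_moment 2 (t * M)"
        using M by (simp add: moment_column_def M_def[symmetric] power2_eq_square del: of_nat_Suc)
      moreover have "2 / t ^ 3 * (1 / M ^ 2) = M * (2 / (t * M) ^ 3)"
        using M t by (simp add: power2_eq_square power3_eq_cube)
      ultimately show ?thesis by (simp only: right_diff_distrib)
    qed
    also have "\<bar>\<dots>\<bar> \<le> M * (33 / (t * M * (1 + t * M) ^ 2))"
      unfolding abs_mult using exp_moment_2_approx[of "t * M"] t M by (intro mult_mono) auto
    also have "\<dots> = (33 / t) * (1 / (1 + t * M)\<^sup>2)" using t M by (simp add: field_simps)
    finally show "\<bar>moment_column 2 t m - 2 / t ^ 3 * (1 / real (Suc m) ^ 2)\<bar> \<le> (33 / t) * (1 / (1 + t * real (Suc m))\<^sup>2)"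
      by (simp only: M_def)
  qed (use t in auto)
  thus ?thesis by (simp add: power2_eq_square)
qed

subsection \<open>The moment of order zero\<close>

lemma moment_row_0:
  assumes t: "t > 0"
  shows "moment_row 0 t k = - ln (1 - exp (- t * real (Suc k)))"
proof -
  define q where "q = exp (- t * real (Suc k))"
  have q: "0 < q" "q < 1" using t by (simp_all add: q_def mult_pos_pos del: of_nat_Suc)
  have "(\<lambda>n. - (- ((- (- q)) ^ n) / real n)) sums (- ln (1 + - q))"
    using sums_minus[OF ln_series'[of "-q"]] q by simp
  hence "(\<lambda>n. q ^ n / real n) sums (- ln (1 - q))" by simp
  hence "(\<lambda>n. q ^ Suc n / real (Suc n)) sums (- ln (1 - q))"
    by (subst sums_Suc_iff) simp
  moreover have "moment_term 0 t k m = q ^ Suc m / real (Suc m)" for m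
    unfolding moment_term_def q_def exp_of_nat_mult[symmetric] by (simp add: mult_ac del: of_nat_Suc)
  ultimately show ?thesis by (simp add: moment_row_def sums_iff q_def)
qed

text \<open>The difference is bounded both by 1 and by 1 / y, hence by 1 / sqrt y. This intermediate
  exponent makes the errors in \<open>moment_0_limit\<close> summable over the columns while keeping
  a positive power of t.\<close>

lemma inverse_exp_minus_one_bounds:
  fixes y :: real
  assumes y: "y > 0"
  shows "\<bar>1 / (exp y - 1) - 1 / y\<bar> \<le> 1 / sqrt y"
proof -
  have e: "exp y - 1 \<ge> y" "exp y - 1 > 0" using exp_ge_add_one_self[of y] y by linarith+
  define D where "D = 1 / y - 1 / (exp y - 1)"
  have 0: "D \<ge> 0" using e y unfolding D_def by (simp add: divide_left_mono)
  have "1 - y \<le> exp (- y)" using exp_ge_add_one_self[of "-y"] by simp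
  hence "(1 - y) * exp y \<le> exp (- y) * exp y" by (intro mult_right_mono) auto
  hence "(1 - y) * exp y \<le> 1" by (simp flip: exp_add)
  hence "D \<le> 1" using e y unfolding D_def by (simp add: field_simps)
  moreover have "D \<le> 1 / y" using e unfolding D_def by simp
  ultimately have "D \<le> 1 / sqrt y"
  proof (cases "y \<le> 1")
    case True
    hence "1 \<le> 1 / sqrt y" using y by simp
    thus ?thesis using \<open>D \<le> 1\<close> by linarith
  next
    case False
    hence "sqrt y * 1 \<le> sqrt y * sqrt y" by (intro mult_left_mono) auto
    hence "1 / y \<le> 1 / sqrt y" using y by (intro divide_left_mono) auto
    thus ?thesis using \<open>D \<le> 1 / y\<close> by linarith
  qed
  thus ?thesis using 0 by (simp add: D_def)
qed

text \<open>With M = m + 1, the columns times t differ from 1 / M^2 by at most sqrt t / M^(3/2).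
  Such a weak rate is enough, because the limit only serves to identify the limit of Riemann sums
  whose rate is obtained separately.\<close>

lemma moment_0_limit: "((\<lambda>t. t * moment 0 t) \<longlongrightarrow> pi\<^sup>2 / 6) (at_right 0)"
proof -
  define K where "K = (\<Sum>m. real (Suc m) powr (- 3 / 2))"
  have sK: "summable (\<lambda>m. real (Suc m) powr (- 3 / 2))"
    by (subst summable_Suc_iff) (simp add: summable_real_powr_iff)
  have le: "\<bar>t * moment 0 t - pi\<^sup>2 / 6\<bar> \<le> sqrt t * K" if t: "t > 0" for t
  proof -
    have s: "(\<lambda>m. t * moment_column 0 t m - 1 / real (Suc m) ^ 2) sums (t * moment 0 t - pi\<^sup>2 / 6)"
      using sums_diff[OF sums_mult[OF moment_column_sums[OF t]] summable_sums[OF summable_inverse_squares]]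
      unfolding suminf_inverse_squares by simp
    have b: "norm (t * moment_column 0 t m - 1 / real (Suc m) ^ 2) \<le> sqrt t * real (Suc m) powr (- 3 / 2)" for m
    proof -
      define M where "M = real (Suc m)"
      have M: "M > 0" by (simp add: M_def)
      have "t * moment_column 0 t m - 1 / M ^ 2 = t / M * (1 / (exp (t * M) - 1) - 1 / (t * M))"
        using t M by (simp add: moment_column_def exp_moment_0 M_def[symmetric] right_diff_distrib power2_eq_square del: of_nat_Suc)
      also have "\<bar>\<dots>\<bar> \<le> t / M * (1 / sqrt (t * M))"
        unfolding abs_mult using inverse_exp_minus_one_bounds[of "t * M"] t M by (intro mult_mono) auto
      also have "\<dots> = sqrt t * M powr (- 3 / 2)"
      proof -
        have "M powr (3 / 2) = M * sqrt M"
          using M powr_add[of M 1 "1 / 2"] by (simp add: powr_half_sqrt)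
        moreover have "M powr (- 3 / 2) = 1 / M powr (3 / 2)" by (simp add: powr_minus_divide)
        moreover have "t / sqrt t = sqrt t" using t by (simp add: real_div_sqrt)
        moreover have "t / M * (1 / sqrt (t * M)) = t / sqrt t * (1 / (M * sqrt M))"
          by (simp add: real_sqrt_mult)
        ultimately show ?thesis by simp
      qed
      finally show ?thesis by (simp only: M_def real_norm_def)
    qed
    have "norm (\<Sum>m. t * moment_column 0 t m - 1 / real (Suc m) ^ 2) \<le> (\<Sum>m. sqrt t * real (Suc m) powr (- 3 / 2))"
      by (intro norm_suminf_le b summable_mult sK)
    also have "\<dots> = sqrt t * K" unfolding K_def by (intro suminf_mult sK)
    finally show ?thesis using s by (simp only: sums_iff real_norm_def)
  qed
  have "((\<lambda>t. t * moment 0 t - pi\<^sup>2 / 6) \<longlongrightarrow> 0) (at_right 0)"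
  proof (rule Lim_null_comparison)
    show "eventually (\<lambda>t. norm (t * moment 0 t - pi\<^sup>2 / 6) \<le> sqrt t * K) (at_right 0)"
      using le by (auto simp: eventually_at_right_less intro: eventually_mono[OF eventually_at_right_less])
    show "((\<lambda>t. sqrt t * K) \<longlongrightarrow> 0) (at_right 0)" by (intro tendsto_mult_left_zero) real_asymp
  qed
  thus ?thesis by (simp add: LIM_zero_iff)
qed

text \<open>Euler's product for the sine, taken at the imaginary argument i pi x.\<close>

lemma sinh_product_formula:
  fixes x :: real
  assumes x: "x > 0"
  shows "(\<lambda>n. \<Prod>k<n. 1 + x\<^sup>2 / real (Suc k) ^ 2) \<longlonglongrightarrow> sinh (pi * x) / (pi * x)"
proof -
  define z where "z = \<i> * complex_of_real x"
  have "(\<lambda>n. (of_real pi * z * (\<Prod>k=1..n. 1 - z\<^sup>2 / of_nat k ^ 2)) / (of_real pi * z))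
     \<longlonglongrightarrow> sin (of_real pi * z) / (of_real pi * z)"
    using x by (intro tendsto_divide sin_product_formula_complex tendsto_const) (auto simp: z_def)
  also have "sin (of_real pi * z) / (of_real pi * z) = of_real (sinh (pi * x) / (pi * x))"
  proof -
    have "sinh (complex_of_real (pi * x)) = of_real (sinh (pi * x))"
      unfolding sinh_field_def by (simp flip: exp_of_real)
    hence "sin (of_real pi * z) = \<i> * of_real (sinh (pi * x))"
      using sin_conv_sinh[of "of_real pi * z"] by (simp add: z_def mult_ac)
    thus ?thesis by (simp add: z_def)
  qed
  also have "(\<lambda>n. (of_real pi * z * (\<Prod>k=1..n. 1 - z\<^sup>2 / of_nat k ^ 2)) / (of_real pi * z))
     = (\<lambda>n. of_real (\<Prod>k<n. 1 + x\<^sup>2 / real (Suc k) ^ 2))"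
  proof
    fix n
    have "(\<Prod>k=1..n. 1 - z\<^sup>2 / of_nat k ^ 2) = (\<Prod>k<n. 1 - z\<^sup>2 / of_nat (Suc k) ^ 2)"
      by (simp add: prod.atLeast1_atMost_eq)
    thus "(of_real pi * z * (\<Prod>k=1..n. 1 - z\<^sup>2 / of_nat k ^ 2)) / (of_real pi * z)
      = of_real (\<Prod>k<n. 1 + x\<^sup>2 / real (Suc k) ^ 2)"
      using x by (simp add: z_def power_mult_distrib)
  qed
  finally show ?thesis by (subst (asm) tendsto_of_real_iff)
qed

text \<open>Near 0 the singularity of \<open>- ln (1 - exp (- y))\<close> is that of \<open>ln (1 + 1 / y\<^sup>2) / 2\<close>, whose sum over
  \<open>y = k t\<close> is known exactly from the product formula for \<open>sinh\<close>. The difference is smooth with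
  value 0 at 0, so its sum has no constant term in its expansion in \<open>t\<close>.\<close>

definition log_diff :: "real \<Rightarrow> real" where
  "log_diff y = (if y = 0 then 0 else - ln (1 - exp (- y)) - ln (1 + 1 / y\<^sup>2) / 2)"

text \<open>The sum of \<open>log_diff\<close> over the positive multiples of t, as
  \<open>log_diff_sums\<close> shows; it is written in this form so that the moment of order 0 can
  be read off from it.\<close>

definition log_diff_sum :: "real \<Rightarrow> real" where
  "log_diff_sum t = moment 0 t - ln (sinh (pi / t) / (pi / t)) / 2"

lemma log_diff_sums:
  assumes t: "t > 0"
  shows "(\<lambda>k. log_diff (t * real (Suc k))) sums log_diff_sum t"
proof -
  have "(\<lambda>n. ln (\<Prod>k<n. 1 + (1 / t)\<^sup>2 / real (Suc k) ^ 2)) \<longlonglongrightarrow> ln (sinh (pi * (1 / t)) / (pi * (1 / t)))"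
    using t by (intro tendsto_ln sinh_product_formula) auto
  moreover have "ln (\<Prod>k<n. 1 + (1 / t)\<^sup>2 / real (Suc k) ^ 2) = (\<Sum>k<n. ln (1 + 1 / (t * real (Suc k))\<^sup>2))" for n
  proof (subst ln_prod)
    have "0 < 1 + (1 / t)\<^sup>2 / real (Suc k) ^ 2" for k by (intro add_pos_nonneg) auto
    thus "1 + (1 / t)\<^sup>2 / real (Suc k) ^ 2 \<noteq> 0" for k by (metis less_irrefl)
  qed (simp_all add: power_mult_distrib power_divide)
  ultimately have "(\<lambda>k. ln (1 + 1 / (t * real (Suc k))\<^sup>2)) sums ln (sinh (pi / t) / (pi / t))"
    by (simp add: sums_def)
  moreover have "(\<lambda>k. - ln (1 - exp (- t * real (Suc k)))) sums moment 0 t"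
    using summable_sums[OF summable_moment_row[OF t, of 0]]
    unfolding moment_def moment_row_0[OF t] moment_row_0[OF t, abs_def] .
  ultimately have "(\<lambda>k. - ln (1 - exp (- t * real (Suc k))) - ln (1 + 1 / (t * real (Suc k))\<^sup>2) / 2) sums log_diff_sum t"
    unfolding log_diff_sum_def by (intro sums_diff sums_divide)
  thus ?thesis using t by (simp add: log_diff_def del: of_nat_Suc)
qed

definition log_diff' :: "real \<Rightarrow> real" where
  "log_diff' y = - 1 / (exp y - 1) + 1 / (y * (1 + y\<^sup>2))"

lemma log_diff_deriv:
  assumes y: "y > 0"
  shows "(log_diff has_real_derivative log_diff' y) (at y)"
proof -
  have pos: "1 + 1 / y\<^sup>2 > 0" by (intro add_pos_nonneg) auto
  have "((\<lambda>y. 1 + 1 / y\<^sup>2) has_real_derivative - 2 / y ^ 3) (at y)"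
    using y by (auto intro!: derivative_eq_intros simp: field_simps power2_eq_square power3_eq_cube)
  from DERIV_chain2[OF DERIV_ln_divide[OF pos] this]
  have 1: "((\<lambda>y. ln (1 + 1 / y\<^sup>2)) has_real_derivative (- 2 / y ^ 3) / (1 + 1 / y\<^sup>2)) (at y)"
    by (simp add: mult.commute)
  have 2: "((\<lambda>y. ln (1 - exp (- y))) has_real_derivative exp (-y) / (1 - exp (-y))) (at y)"
    using y by (auto intro!: derivative_eq_intros)
  have "((\<lambda>y. - ln (1 - exp (- y)) - ln (1 + 1 / y\<^sup>2) / 2) has_real_derivative
      - (exp (-y) / (1 - exp (-y))) - (- 2 / y ^ 3) / (1 + 1 / y\<^sup>2) / 2) (at y)"
    by (intro DERIV_diff DERIV_minus DERIV_cdivide 1 2)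
  also have "- (exp (-y) / (1 - exp (-y))) - (- 2 / y ^ 3) / (1 + 1 / y\<^sup>2) / 2 = log_diff' y"
  proof -
    have "exp (-y) / (1 - exp (-y)) = 1 / (exp y - 1)" using y by (simp add: exp_minus field_simps)
    moreover have "(- 2 / y ^ 3) / (1 + 1 / y\<^sup>2) / 2 = - (1 / (y * (1 + y\<^sup>2)))"
    proof -
      have "y ^ 3 * (1 + 1 / y\<^sup>2) = y * (1 + y\<^sup>2)" using y by (simp add: field_simps power2_eq_square power3_eq_cube)
      thus ?thesis by simp
    qed
    ultimately show ?thesis by (simp add: log_diff'_def)
  qed
  finally show ?thesis
    by (rule has_field_derivative_transform_within_open[of _ _ _ "{0<..}"])
      (use y in \<open>auto simp: log_diff_def\<close>)
qed

text \<open>The derivative of - 1 / (exp y - 1) is \<open>exp_moment 1 y\<close>. The rational part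
  is split so that the pole 1 / y^2 is paired with it: what remains is the quantity bounded in
  \<open>exp_moment_1_approx\<close> plus a rational function without a pole.\<close>

lemma log_diff'_deriv:
  assumes y: "y > 0"
  shows "(log_diff' has_real_derivative exp_moment 1 y - 1 / y\<^sup>2 + (y\<^sup>2 - 1) / (1 + y\<^sup>2)\<^sup>2) (at y)"
proof -
  have nz: "y * (1 + y\<^sup>2) \<noteq> 0" using y zero_le_power2[of y] by (auto simp: add_nonneg_eq_0_iff)
  have "(log_diff' has_real_derivative exp y / (exp y - 1)\<^sup>2 - (1 + 3 * y\<^sup>2) / (y * (1 + y\<^sup>2))\<^sup>2) (at y)"
  proof -
    have "((\<lambda>y. y * (1 + y\<^sup>2)) has_real_derivative 1 + 3 * y\<^sup>2) (at y)"
      by (auto intro!: derivative_eq_intros simp: power2_eq_square algebra_simps)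
    from DERIV_inverse_fun[OF this nz]
    have 1: "((\<lambda>y. 1 / (y * (1 + y\<^sup>2))) has_real_derivative - ((1 + 3 * y\<^sup>2) / (y * (1 + y\<^sup>2))\<^sup>2)) (at y)"
      by (simp add: inverse_eq_divide power2_eq_square)
    have "((\<lambda>y. - 1 / (exp y - 1)) has_real_derivative exp y / (exp y - 1)\<^sup>2) (at y)"
      using y by (auto intro!: derivative_eq_intros simp: power2_eq_square)
    from DERIV_add[OF this 1] show ?thesis by (simp add: log_diff'_def[abs_def])
  qed
  also have "exp y / (exp y - 1)\<^sup>2 = exp_moment 1 y"
  proof -
    have "exp y - 1 = 2 * exp (y / 2) * sinh (y / 2)"
      by (simp add: sinh_field_def algebra_simps flip: exp_add)
    hence "exp y / (exp y - 1)\<^sup>2 = exp y / ((exp (y / 2))\<^sup>2 * (4 * sinh (y / 2) ^ 2))"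
      by (simp add: power_mult_distrib mult_ac)
    also have "(exp (y / 2))\<^sup>2 = exp y" by (simp flip: exp_double)
    finally show ?thesis using exp_moment_1[OF y] by simp
  qed
  also have "exp_moment 1 y - (1 + 3 * y\<^sup>2) / (y * (1 + y\<^sup>2))\<^sup>2
      = exp_moment 1 y - 1 / y\<^sup>2 + (y\<^sup>2 - 1) / (1 + y\<^sup>2)\<^sup>2"
  proof -
    have 1: "1 + y\<^sup>2 \<noteq> 0" "y \<noteq> 0" using nz by auto
    have "1 / y\<^sup>2 - (y\<^sup>2 - 1) / (1 + y\<^sup>2)\<^sup>2 = (1 * (1 + y\<^sup>2)\<^sup>2 - (y\<^sup>2 - 1) * y\<^sup>2) / (y\<^sup>2 * (1 + y\<^sup>2)\<^sup>2)"
      using 1 by (intro diff_frac_eq) auto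
    also have "1 * (1 + y\<^sup>2)\<^sup>2 - (y\<^sup>2 - 1) * y\<^sup>2 = 1 + 3 * y\<^sup>2" by (simp add: power2_eq_square algebra_simps)
    finally show ?thesis by (simp add: power_mult_distrib)
  qed
  finally show ?thesis .
qed

lemma log_diff''_bound:
  assumes y: "(y::real) > 0"
  shows "\<bar>exp_moment 1 y - 1 / y\<^sup>2 + (y\<^sup>2 - 1) / (1 + y\<^sup>2)\<^sup>2\<bar> \<le> 6 / (1 + y)\<^sup>2"
proof -
  have p: "1 + y\<^sup>2 > 0" using y by (simp add: add_pos_nonneg)
  have "\<bar>y\<^sup>2 - 1\<bar> \<le> 1 + y\<^sup>2" by (simp add: abs_le_iff)
  hence "\<bar>y\<^sup>2 - 1\<bar> / (1 + y\<^sup>2)\<^sup>2 \<le> (1 + y\<^sup>2) / (1 + y\<^sup>2)\<^sup>2" by (intro divide_right_mono) auto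
  also have "\<dots> = 1 / (1 + y\<^sup>2)" using p by (simp add: power2_eq_square)
  also have "\<dots> \<le> 2 / (1 + y)\<^sup>2"
    using p y zero_le_square[of "1 - y"] by (simp add: field_simps power2_eq_square)
  finally have "\<bar>(y\<^sup>2 - 1) / (1 + y\<^sup>2)\<^sup>2\<bar> \<le> 2 / (1 + y)\<^sup>2" by simp
  thus ?thesis using exp_moment_1_approx[OF y] by linarith
qed

text \<open>At the end point both logarithmic terms are asymptotic to the same multiple of ln y and
  cancel. Continuity there lets the mean value theorem start at 0, where no derivative is at
  hand.\<close>

lemma continuous_on_log_diff: "continuous_on {0..} log_diff"
proof (unfold continuous_on_eq_continuous_within, rule ballI)
  fix x :: real assume x: "x \<in> {0..}"
  show "continuous (at x within {0..}) log_diff"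
  proof (cases "x = 0")
    case False
    thus ?thesis using x log_diff_deriv[of x] by (auto intro: DERIV_isCont continuous_at_imp_continuous_at_within)
  next
    case True
    have "((\<lambda>y::real. - ln (1 - exp (- y)) - ln (1 + 1 / y\<^sup>2) / 2) \<longlongrightarrow> 0) (at_right 0)"
      by real_asymp
    hence "(log_diff \<longlongrightarrow> 0) (at_right 0)"
      by (rule Lim_transform_eventually)
        (auto simp: log_diff_def eventually_at_filter)
    thus ?thesis using True by (simp add: continuous_within at_within_Ici_at_right log_diff_def)
  qed
qed

text \<open>The mean value theorem on two adjacent intervals turns the second difference into h
  times a difference of \<open>log_diff'\<close> at points less than 2 h apart; a further
  application brings in the second derivative, and 12 = 2 * 6.\<close>

lemma log_diff_second_difference:
  assumes a: "a \<ge> 0" and h: "h > 0"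
  shows "\<bar>log_diff (a + 2 * h) - 2 * log_diff (a + h) + log_diff a\<bar> \<le> 12 * h\<^sup>2 / (1 + a)\<^sup>2"
proof -
  have step: "\<exists>z>b. z < b + h \<and> log_diff (b + h) - log_diff b = h * log_diff' z" if b: "b \<ge> 0" for b
  proof -
    have "continuous_on {b..b + h} log_diff"
      using continuous_on_log_diff by (rule continuous_on_subset) (use b in auto)
    moreover have "(log_diff has_derivative (\<lambda>v. v * log_diff' x)) (at x)" if "b < x" for x
    proof -
      have "(*) (log_diff' x) = (\<lambda>v. v * log_diff' x)" by auto
      thus ?thesis using log_diff_deriv[of x] that b by (simp add: has_field_derivative_def)
    qed
    ultimately obtain z where "z \<in> {b<..<b + h}" "log_diff (b + h) - log_diff b = (b + h - b) * log_diff' z"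
      using mvt[of b "b + h" log_diff "\<lambda>x v. v * log_diff' x"] h by (metis greaterThanLessThan_iff less_add_same_cancel1)
    thus ?thesis by auto
  qed
  obtain z1 where z1: "a < z1" "z1 < a + h" "log_diff (a + h) - log_diff a = h * log_diff' z1"
    using step[OF a] by auto
  obtain z2 where z2: "a + h < z2" "z2 < a + h + h" "log_diff (a + h + h) - log_diff (a + h) = h * log_diff' z2"
    using step[of "a + h"] a h by auto
  have "\<exists>z>z1. z < z2 \<and> log_diff' z2 - log_diff' z1 =
      (z2 - z1) * (exp_moment 1 z - 1 / z\<^sup>2 + (z\<^sup>2 - 1) / (1 + z\<^sup>2)\<^sup>2)"
  proof (rule MVT2)
    show "z1 < z2" using z1 z2 by linarith
    show "(log_diff' has_real_derivative exp_moment 1 x - 1 / x\<^sup>2 + (x\<^sup>2 - 1) / (1 + x\<^sup>2)\<^sup>2) (at x)"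
      if "z1 \<le> x" for x using that z1 a by (intro log_diff'_deriv) linarith
  qed
  then obtain z where z: "z1 < z" "z < z2" and eq: "log_diff' z2 - log_diff' z1 =
      (z2 - z1) * (exp_moment 1 z - 1 / z\<^sup>2 + (z\<^sup>2 - 1) / (1 + z\<^sup>2)\<^sup>2)" by blast
  have "log_diff (a + 2 * h) - 2 * log_diff (a + h) + log_diff a
      = (log_diff (a + h + h) - log_diff (a + h)) - (log_diff (a + h) - log_diff a)"
    by (simp add: algebra_simps)
  also have "\<dots> = h * (log_diff' z2 - log_diff' z1)" unfolding z1 z2 by (simp add: algebra_simps)
  also have "\<bar>\<dots>\<bar> = h * ((z2 - z1) * \<bar>exp_moment 1 z - 1 / z\<^sup>2 + (z\<^sup>2 - 1) / (1 + z\<^sup>2)\<^sup>2\<bar>)"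
    unfolding eq abs_mult using h z1 z2 by simp
  also have "\<dots> \<le> h * ((2 * h) * (6 / (1 + a)\<^sup>2))"
  proof (intro mult_left_mono mult_mono)
    have "\<bar>exp_moment 1 z - 1 / z\<^sup>2 + (z\<^sup>2 - 1) / (1 + z\<^sup>2)\<^sup>2\<bar> \<le> 6 / (1 + z)\<^sup>2"
      using z z1 a by (intro log_diff''_bound) auto
    also have "\<dots> \<le> 6 / (1 + a)\<^sup>2" using z z1 a by (intro divide_left_mono power_mono) auto
    finally show "\<bar>exp_moment 1 z - 1 / z\<^sup>2 + (z\<^sup>2 - 1) / (1 + z\<^sup>2)\<^sup>2\<bar> \<le> 6 / (1 + a)\<^sup>2" .
  qed (use z1 z2 h in auto)
  finally show ?thesis by (simp add: power2_eq_square mult_ac)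
qed

text \<open>Comparing step sizes \<open>t\<close> and \<open>t / 2\<close> avoids evaluating the integral of \<^const>\<open>log_diff\<close>: the limit of
  the Riemann sums is obtained from \<open>moment_0_limit\<close> instead.\<close>

lemma log_diff_sum_halving:
  assumes t: "0 < t" "t \<le> 1"
  shows "\<bar>t * log_diff_sum t - t / 2 * log_diff_sum (t / 2)\<bar> \<le> 3 * t\<^sup>2"
proof -
  define G where "G = log_diff"
  have 1: "(\<lambda>k. G (t * real (Suc k))) sums log_diff_sum t" unfolding G_def using t by (intro log_diff_sums)
  have "(\<lambda>k. G (t / 2 * real (Suc k))) sums log_diff_sum (t / 2)" unfolding G_def using t by (intro log_diff_sums) auto
  hence "(\<lambda>n. \<Sum>k=n*2..<n*2+2. G (t / 2 * real (Suc k))) sums log_diff_sum (t / 2)"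
    by (rule sums_group) simp
  moreover have "{n*2..<n*2+2} = {2 * n, Suc (2 * n)}" for n :: nat by auto
  hence "(\<Sum>k=n*2..<n*2+2. G (t / 2 * real (Suc k))) = G (t * real n + t / 2) + G (t * real (Suc n))" for n
    by (simp add: algebra_simps add_divide_distrib)
  ultimately have 2: "(\<lambda>n. G (t * real n + t / 2) + G (t * real (Suc n))) sums log_diff_sum (t / 2)" by simp
  have "(\<lambda>k. G (t * real (Suc k))) \<longlonglongrightarrow> 0" using 1 by (intro summable_LIMSEQ_zero) (simp add: sums_iff)
  hence "(\<lambda>k. G (t * real k)) \<longlonglongrightarrow> 0" by (rule LIMSEQ_imp_Suc)
  from telescope_sums[OF this]
  have 3: "(\<lambda>k. G (t * real (Suc k)) - G (t * real k)) sums 0" by (simp add: G_def log_diff_def)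
  \<comment> \<open>Subtracting the telescoping series, whose sum is 0 because
    \<open>log_diff\<close> vanishes at 0, symmetrises the comparison: each term becomes a second
    difference with step t / 2. Without it the terms would only be first differences, losing a power
    of t.\<close>
  have "(\<lambda>n. 4 * G (t * real (Suc n)) - 2 * (G (t * real n + t / 2) + G (t * real (Suc n)))
            - (G (t * real (Suc n)) - G (t * real n)))
      sums (4 * log_diff_sum t - 2 * log_diff_sum (t / 2) - 0)"
    by (intro sums_diff sums_mult 1 2 3)
  also have "(\<lambda>n. 4 * G (t * real (Suc n)) - 2 * (G (t * real n + t / 2) + G (t * real (Suc n)))
            - (G (t * real (Suc n)) - G (t * real n)))
      = (\<lambda>n. G (t * real n + 2 * (t / 2)) - 2 * G (t * real n + t / 2) + G (t * real n))"
    by (simp add: fun_eq_iff algebra_simps)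
  finally have 4: "(\<lambda>n. G (t * real n + 2 * (t / 2)) - 2 * G (t * real n + t / 2) + G (t * real n))
     sums (4 * log_diff_sum t - 2 * log_diff_sum (t / 2))" by simp
  have "\<bar>(4 * log_diff_sum t - 2 * log_diff_sum (t / 2)) - 0\<bar> \<le> (12 * t\<^sup>2) / t"
  proof (rule sums_approx[OF 4 sums_zero])
    fix n
    have "\<bar>G (t * real n + 2 * (t / 2)) - 2 * G (t * real n + t / 2) + G (t * real n)\<bar>
        \<le> 12 * (t / 2)\<^sup>2 / (1 + t * real n)\<^sup>2"
      unfolding G_def using t by (intro log_diff_second_difference) auto
    also have "\<dots> = 3 * t\<^sup>2 * (1 / (1 + t * real n))\<^sup>2" by (simp add: power_divide)
    \<comment> \<open>The shift from n to n + 1, needed for \<open>sums_approx\<close>, costs a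
      factor 2 because t \<le> 1.\<close>
    also have "1 / (1 + t * real n) \<le> 2 / (1 + t * real (Suc n))"
    proof -
      define b where "b = t * real n"
      have b: "b \<ge> 0" "t * real (Suc n) = b + t" using t by (simp_all add: b_def algebra_simps)
      have "1 / (1 + b) \<le> 2 / (1 + (b + t))" using t b(1) by (simp add: divide_simps)
      thus ?thesis by (simp only: b b_def)
    qed
    hence "3 * t\<^sup>2 * (1 / (1 + t * real n))\<^sup>2 \<le> 3 * t\<^sup>2 * (2 / (1 + t * real (Suc n)))\<^sup>2"
      using t by (intro mult_left_mono power_mono) auto
    also have "\<dots> = 12 * t\<^sup>2 * (1 / (1 + t * real (Suc n))\<^sup>2)" by (simp add: power_divide)
    finally show "\<bar>G (t * real n + 2 * (t / 2)) - 2 * G (t * real n + t / 2) + G (t * real n) - 0\<bar>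
        \<le> 12 * t\<^sup>2 * (1 / (1 + t * real (Suc n))\<^sup>2)" by simp
  qed (use t in auto)
  also have "(12 * t\<^sup>2) / t = 12 * t" using t by (simp add: power2_eq_square)
  finally have "(t / 4) * \<bar>4 * log_diff_sum t - 2 * log_diff_sum (t / 2)\<bar> \<le> (t / 4) * (12 * t)"
    using t by (intro mult_left_mono) auto
  also have "(t / 4) * \<bar>4 * log_diff_sum t - 2 * log_diff_sum (t / 2)\<bar>
     = \<bar>(t / 4) * (4 * log_diff_sum t - 2 * log_diff_sum (t / 2))\<bar>" using t by (simp add: abs_mult)
  also have "(t / 4) * (4 * log_diff_sum t - 2 * log_diff_sum (t / 2)) = t * log_diff_sum t - t / 2 * log_diff_sum (t / 2)"
    by (simp add: algebra_simps)
  finally show ?thesis by (simp add: power2_eq_square)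
qed

section \<open>Evaluation of the moment of order zero\<close>

lemma ln_sinh_quotient:
  fixes t :: real
  assumes t: "t > 0"
  shows "ln (sinh (pi / t) / (pi / t)) / 2 = pi / (2 * t) + ln (t / (2 * pi)) / 2 + ln (1 - exp (- 2 * pi / t)) / 2"
proof -
  have "exp (- 2 * pi / t) < 1" using t by simp
  moreover have "sinh (pi / t) / (pi / t) = exp (pi / t) * (t / (2 * pi)) * (1 - exp (- 2 * pi / t))"
    using t by (simp add: sinh_field_def field_simps flip: exp_add)
  moreover have "ln (exp a * b * c) = a + ln b + ln c" if "b > 0" "c > 0" for a b c :: real
    using that by (simp add: ln_mult)
  ultimately have "ln (sinh (pi / t) / (pi / t)) = pi / t + ln (t / (2 * pi)) + ln (1 - exp (- 2 * pi / t))"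
    using t by (simp only: diff_gt_0_iff_gt zero_less_divide_iff mult_pos_pos pi_gt_zero zero_less_numeral simp_thms)
  thus ?thesis by (simp add: add_divide_distrib)
qed

lemma log_diff_sum_limit: "((\<lambda>t. t * log_diff_sum t) \<longlongrightarrow> pi\<^sup>2 / 6 - pi / 2) (at_right 0)"
proof -
  have "((\<lambda>t. t * (pi / (2 * t) + ln (t / (2 * pi)) / 2 + ln (1 - exp (- 2 * pi / t)) / 2)) \<longlongrightarrow> pi / 2) (at_right 0)"
    by real_asymp
  hence "((\<lambda>t. t * (ln (sinh (pi / t) / (pi / t)) / 2)) \<longlongrightarrow> pi / 2) (at_right 0)"
    by (rule Lim_transform_eventually)
      (rule eventually_mono[OF eventually_at_right_less], simp only: ln_sinh_quotient)
  from tendsto_diff[OF moment_0_limit this] show ?thesis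
    by (simp add: log_diff_sum_def right_diff_distrib)
qed

text \<open>Repeated halving changes the value by at most 3 t^2 / 4^j at stage j; these errors add
  up to at most 4 t^2, and the halved values tend to the known limit.\<close>

lemma log_diff_sum_approx:
  assumes t: "0 < t" "t \<le> 1"
  shows "\<bar>t * log_diff_sum t - (pi\<^sup>2 / 6 - pi / 2)\<bar> \<le> 4 * t\<^sup>2"
proof -
  define T where "T j = t / 2 ^ j * log_diff_sum (t / 2 ^ j)" for j :: nat
  have "t / 2 ^ j \<le> 1" for j :: nat using t by (simp add: field_simps order.trans[OF _ one_le_power])
  hence step: "\<bar>T j - T (Suc j)\<bar> \<le> 3 * (t / 2 ^ j)\<^sup>2" for j
    using log_diff_sum_halving[of "t / 2 ^ j"] t by (simp add: T_def mult_ac)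
  have le: "\<bar>T 0 - T n\<bar> \<le> 4 * t\<^sup>2 * (1 - 1 / 4 ^ n)" for n
  proof (induction n)
    case (Suc n)
    have "\<bar>T 0 - T (Suc n)\<bar> \<le> \<bar>T 0 - T n\<bar> + \<bar>T n - T (Suc n)\<bar>" by linarith
    also have "\<dots> \<le> 4 * t\<^sup>2 * (1 - 1 / 4 ^ n) + 3 * (t / 2 ^ n)\<^sup>2" using Suc step by (intro add_mono)
    also have "(t / 2 ^ n)\<^sup>2 = t\<^sup>2 / 4 ^ n"
      by (simp add: power_divide power_mult[symmetric] mult.commute[of n]) (simp add: power_mult)
    finally show ?case by (simp add: algebra_simps)
  qed simp
  have "filterlim (\<lambda>n. t / 2 ^ n) (at_right 0) sequentially"
    using t by real_asymp
  from filterlim_compose[OF log_diff_sum_limit this]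
  have "T \<longlonglongrightarrow> pi\<^sup>2 / 6 - pi / 2" by (simp add: T_def[abs_def])
  hence "(\<lambda>n. \<bar>T 0 - T n\<bar>) \<longlonglongrightarrow> \<bar>T 0 - (pi\<^sup>2 / 6 - pi / 2)\<bar>" by (intro tendsto_intros)
  moreover have "\<bar>T 0 - T n\<bar> \<le> 4 * t\<^sup>2" for n
  proof -
    have "4 * t\<^sup>2 * (1 - 1 / 4 ^ n) \<le> 4 * t\<^sup>2 * 1" by (intro mult_left_mono) auto
    thus ?thesis using le[of n] by linarith
  qed
  ultimately have "\<bar>T 0 - (pi\<^sup>2 / 6 - pi / 2)\<bar> \<le> 4 * t\<^sup>2"
    by (intro tendsto_upperbound[of _ _ sequentially]) auto
  thus ?thesis by (simp add: T_def)
qed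

text \<open>The term pi / (2 t) in the limit of the Riemann sums cancels against the exponential
  growth of the hyperbolic sine. What is left over is half of ln (1 - exp(- 2 pi / t)), which is far
  smaller than t.\<close>

lemma moment_0_approx:
  assumes t: "0 < t" "t \<le> 1"
  shows "\<bar>moment 0 t - (pi\<^sup>2 / (6 * t) + ln (t / (2 * pi)) / 2)\<bar> \<le> 5 * t"
proof -
  define u where "u = exp (- 2 * pi / t)"
  have "u \<le> t / 6"
  proof -
    have "6 / t \<le> 2 * pi / t" using t pi_gt3 by (intro divide_right_mono) auto
    also have "\<dots> \<le> exp (2 * pi / t)" using exp_ge_add_one_self[of "2 * pi / t"] by linarith
    finally show ?thesis using t unfolding u_def by (simp add: exp_minus field_simps)
  qed
  hence u: "0 < u" "u \<le> t / 6" "u \<le> 1 / 2" using t by (auto simp: u_def)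
  have "- u - 2 * u\<^sup>2 \<le> ln (1 - u)" using u by (intro ln_one_minus_pos_lower_bound) auto
  moreover have "u * u \<le> 1 / 2 * u" using u by (intro mult_right_mono) auto
  moreover have "ln (1 - u) \<le> 0" using u by simp
  ultimately have lnu: "\<bar>ln (1 - u)\<bar> \<le> t" using u t unfolding power2_eq_square by linarith
  have "\<bar>t * (log_diff_sum t - (pi\<^sup>2 / 6 - pi / 2) / t)\<bar> \<le> t * (4 * t)"
  proof -
    have "t * (l - c / t) = t * l - c" for l c using t by (simp add: right_diff_distrib)
    thus ?thesis using log_diff_sum_approx[OF t] by (simp only: power2_eq_square mult_ac)
  qed
  hence "\<bar>log_diff_sum t - (pi\<^sup>2 / 6 - pi / 2) / t\<bar> \<le> 4 * t"
    using t by (simp add: abs_mult)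
  moreover have "moment 0 t = log_diff_sum t + (pi / (2 * t) + ln (t / (2 * pi)) / 2 + ln (1 - u) / 2)"
    using ln_sinh_quotient[OF t(1)] by (simp add: log_diff_sum_def u_def)
  moreover have "(pi\<^sup>2 / 6 - pi / 2) / t = pi\<^sup>2 / (6 * t) - pi / (2 * t)" by (simp add: diff_divide_distrib mult_ac)
  ultimately show ?thesis using lnu by linarith
qed

subsection \<open>A saddle point estimate\<close>

lemma gaussian_integral:
  fixes a :: real
  assumes a: "a > 0"
  shows "integrable lborel (\<lambda>x. exp (- a * x\<^sup>2))" "(LINT x|lborel. exp (- a * x\<^sup>2)) = sqrt (pi / a)"
proof -
  define s where "s = 1 / sqrt (2 * a)"
  have s: "s > 0" "s\<^sup>2 = 1 / (2 * a)" using a by (simp_all add: s_def power_divide)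
  have eq: "exp (- a * x\<^sup>2) = sqrt (pi / a) * normal_density 0 s x" for x
  proof -
    have "normal_density 0 s x = 1 / sqrt (pi / a) * exp (- a * x\<^sup>2)"
      using a by (simp add: normal_density_def s mult_ac)
    thus ?thesis using a by simp
  qed
  show "integrable lborel (\<lambda>x. exp (- a * x\<^sup>2))"
    unfolding eq using s by (intro integrable_mult_right integrable_normal_density)
  show "(LINT x|lborel. exp (- a * x\<^sup>2)) = sqrt (pi / a)"
    unfolding eq using s by (simp add: integral_normal_density)
qed

lemma power_exp_le:
  fixes a y :: real
  assumes "a > 0" "y \<ge> 0"
  shows "y ^ j * exp (- a * y) \<le> fact j / a ^ j"
proof -
  have "(a * y) ^ j * exp (- a * y) \<le> (fact j * exp (a * y)) * exp (- a * y)"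
    using assms by (intro mult_right_mono power_le_fact_exp) auto
  also have "\<dots> = fact j" by (simp add: mult.assoc flip: exp_add)
  finally show ?thesis using assms by (simp add: power_mult_distrib field_simps)
qed

lemma abs_cos_minus_one_le:
  fixes x :: real
  shows "\<bar>cos x - 1\<bar> \<le> x\<^sup>2 / 2"
proof -
  have "cmod (iexp x - (1 + \<i> * x)) \<le> x\<^sup>2 / 2"
    using iexp_approx1[of x 1] by (simp add: eval_nat_numeral)
  moreover have "\<bar>Re (iexp x - (1 + \<i> * x))\<bar> \<le> cmod (iexp x - (1 + \<i> * x))" by (rule abs_Re_le_cmod)
  ultimately show ?thesis by (simp add: Re_exp)
qed

text \<open>With z = - v + i X + R, the factor exp(i X) is unimodular, so R contributes |exp R - 1|.
  Once R is split off, taking the real part leaves cos X - 1, which is quadratic in the phase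
  X.\<close>

lemma Re_exp_gaussian_approx:
  fixes z :: complex and X v r :: real
  assumes "norm (z - Complex (- v) X) \<le> r"
  shows "\<bar>Re (exp z) - exp (- v)\<bar> \<le> exp (- v) * (r * exp r + X\<^sup>2 / 2)"
proof -
  define R where "R = z - Complex (- v) X"
  have "norm (exp R - 1) \<le> exp \<bar>Re R\<bar> * norm R"
    using Taylor_exp[of R 0] by simp
  also have "\<dots> \<le> exp r * r"
    using assms abs_Re_le_cmod[of R] unfolding R_def[symmetric] by (intro mult_mono) auto
  finally have R: "norm (exp R - 1) \<le> r * exp r" by (simp add: mult.commute)
  have "z = of_real (- v) + \<i> * of_real X + R" by (simp add: R_def Complex_eq)
  hence "exp z = of_real (exp (- v)) * (iexp X * exp R)"
    by (simp only: exp_add exp_of_real mult.assoc)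
  hence "Re (exp z) = exp (- v) * Re (iexp X * exp R)" by (metis Re_complex_of_real complex_scaleR scaleR_complex.simps(1) scaleR_conv_of_real)
  moreover have "Re (iexp X * exp R) = Re (iexp X * (exp R - 1)) + cos X"
    by (simp add: right_diff_distrib Re_exp)
  ultimately have "Re (exp z) - exp (- v) = exp (- v) * (Re (iexp X * (exp R - 1)) + (cos X - 1))"
    by (simp add: algebra_simps)
  also have "\<bar>\<dots>\<bar> = exp (- v) * \<bar>Re (iexp X * (exp R - 1)) + (cos X - 1)\<bar>" by (simp add: abs_mult)
  also have "\<dots> \<le> exp (- v) * (r * exp r + X\<^sup>2 / 2)"
  proof (intro mult_left_mono order.trans[OF abs_triangle_ineq] add_mono abs_cos_minus_one_le)
    have "\<bar>Re (iexp X * (exp R - 1))\<bar> \<le> norm (iexp X * (exp R - 1))" by (rule abs_Re_le_cmod)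
    also have "\<dots> = norm (exp R - 1)" by (simp add: norm_mult)
    finally show "\<bar>Re (iexp X * (exp R - 1))\<bar> \<le> r * exp r" using R by linarith
  qed auto
  finally show ?thesis .
qed

text \<open>In the scaled variable y = \<theta>^2 / t^3 the linear phase, the quartic remainder and
  the cubic phase contribute t y, t y^2 and t y^3 up to constants. Half of the Gaussian decay exp(-
  c y / 2) is spent on the exponential of the remainder, a quarter absorbs the powers of y at the
  price j! / (c / 8)^j, and the last quarter is kept for integration.\<close>

lemma saddle_near:
  fixes b s \<kappa> q t \<theta> c K :: real and z :: complex
  assumes t: "0 < t" "t \<le> 1" and c: "c > 0" and K: "K > 0"
    and b: "\<bar>b\<bar> \<le> K / t" and s: "c / t ^ 3 \<le> s" and \<kappa>: "\<bar>\<kappa>\<bar> \<le> K / t ^ 4" and q: "0 \<le> q" "q \<le> K / t ^ 5"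
    and z: "norm (z - Complex (- s * \<theta>\<^sup>2 / 2) (b * \<theta> + \<kappa> * \<theta> ^ 3)) \<le> q * \<theta> ^ 4"
    and \<theta>: "K * \<theta>\<^sup>2 \<le> c / 4 * t\<^sup>2"
  shows "\<bar>Re (exp z) - exp (- s * \<theta>\<^sup>2 / 2)\<bar> \<le>
     (K * (2 / (c / 8)\<^sup>2) + K\<^sup>2 * (1 / (c / 8)) + K\<^sup>2 * (6 / (c / 8) ^ 3)) * t * exp (- (c / 8) * (\<theta>\<^sup>2 / t ^ 3))"
proof -
  define y where "y = \<theta>\<^sup>2 / t ^ 3"
  have y: "y \<ge> 0" using t by (simp add: y_def)
  have \<theta>2: "\<theta>\<^sup>2 = y * t ^ 3" using t by (simp add: y_def)
  have \<theta>4: "\<theta> ^ 4 = y\<^sup>2 * t ^ 6"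
  proof -
    have "\<theta> ^ 4 = (\<theta>\<^sup>2)\<^sup>2" by (simp flip: power_mult)
    thus ?thesis by (simp add: \<theta>2 power_mult_distrib flip: power_mult)
  qed
  have \<theta>6: "\<theta> ^ 6 = y ^ 3 * t ^ 9"
  proof -
    have "\<theta> ^ 6 = (\<theta>\<^sup>2) ^ 3" by (simp flip: power_mult)
    thus ?thesis by (simp add: \<theta>2 power_mult_distrib flip: power_mult)
  qed
  have qK: "q * \<theta> ^ 4 \<le> K * (t * y\<^sup>2)"
  proof -
    have "q * \<theta> ^ 4 \<le> K / t ^ 5 * \<theta> ^ 4" using q by (intro mult_right_mono) auto
    also have "\<dots> = K * (t * y\<^sup>2)" unfolding \<theta>4 using t by (simp add: eval_nat_numeral)
    finally show ?thesis .
  qed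
  have qc: "q * \<theta> ^ 4 \<le> c * y / 4"
  proof -
    have "K * (y * t ^ 3) \<le> c / 4 * t\<^sup>2" using \<theta> by (simp add: \<theta>2)
    hence "K * y * t \<le> c / 4" using t by (simp add: eval_nat_numeral)
    hence "(K * y * t) * y \<le> c / 4 * y" using y by (intro mult_right_mono)
    thus ?thesis using qK by (simp add: power2_eq_square mult_ac)
  qed
  have b2: "(b * \<theta>)\<^sup>2 \<le> K\<^sup>2 * (t * y)"
  proof -
    have "(b * \<theta>)\<^sup>2 \<le> (K / t)\<^sup>2 * \<theta>\<^sup>2"
      unfolding power_mult_distrib using power_mono[OF b abs_ge_zero, of 2] by (intro mult_right_mono) auto
    also have "\<dots> = K\<^sup>2 * (t * y)" unfolding \<theta>2 using t by (simp add: eval_nat_numeral)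
    finally show ?thesis .
  qed
  have k2: "(\<kappa> * \<theta> ^ 3)\<^sup>2 \<le> K\<^sup>2 * (t * y ^ 3)"
  proof -
    have "(\<kappa> * \<theta> ^ 3)\<^sup>2 = \<kappa>\<^sup>2 * \<theta> ^ 6" by (simp add: power_mult_distrib flip: power_mult)
    also have "\<dots> \<le> (K / t ^ 4)\<^sup>2 * \<theta> ^ 6"
      using power_mono[OF \<kappa> abs_ge_zero, of 2] by (intro mult_right_mono) auto
    also have "\<dots> = K\<^sup>2 * (t * y ^ 3)" unfolding \<theta>6 using t by (simp add: eval_nat_numeral)
    finally show ?thesis .
  qed
  have X: "(b * \<theta> + \<kappa> * \<theta> ^ 3)\<^sup>2 / 2 \<le> K\<^sup>2 * (t * y) + K\<^sup>2 * (t * y ^ 3)"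
  proof -
    have "(p + r)\<^sup>2 / 2 \<le> A + B" if "p\<^sup>2 \<le> A" "r\<^sup>2 \<le> B" for p r A B :: real
      using that sum_squares_bound[of p r] by (simp add: power2_sum mult.assoc)
    thus ?thesis using b2 k2 by blast
  qed
  have v: "exp (- (s * \<theta>\<^sup>2 / 2)) \<le> exp (- c * y / 2)"
    using mult_right_mono[OF s, of "\<theta>\<^sup>2"] by (simp add: y_def)
  have "\<bar>Re (exp z) - exp (- (s * \<theta>\<^sup>2 / 2))\<bar> \<le> exp (- (s * \<theta>\<^sup>2 / 2)) *
      (q * \<theta> ^ 4 * exp (q * \<theta> ^ 4) + (b * \<theta> + \<kappa> * \<theta> ^ 3)\<^sup>2 / 2)"
    by (rule Re_exp_gaussian_approx) (use z in simp)
  also have "\<dots> \<le> exp (- c * y / 2) *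
      (K * (t * y\<^sup>2) * exp (c * y / 4) + (K\<^sup>2 * (t * y) + K\<^sup>2 * (t * y ^ 3)))"
  proof (rule mult_mono[OF v add_mono[OF _ X]])
    show "q * \<theta> ^ 4 * exp (q * \<theta> ^ 4) \<le> K * (t * y\<^sup>2) * exp (c * y / 4)"
      by (rule mult_mono[OF qK]) (use qc K t in auto)
  qed (use q in auto)
  also have "\<dots> \<le> exp (- c * y / 2) *
      (K * (t * y\<^sup>2) * exp (c * y / 4) + (K\<^sup>2 * (t * y) + K\<^sup>2 * (t * y ^ 3)) * exp (c * y / 4))"
  proof (intro mult_left_mono add_left_mono)
    have "1 \<le> exp (c * y / 4)" using c y by simp
    thus "K\<^sup>2 * (t * y) + K\<^sup>2 * (t * y ^ 3) \<le> (K\<^sup>2 * (t * y) + K\<^sup>2 * (t * y ^ 3)) * exp (c * y / 4)"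
      using t y mult_left_mono[of 1 "exp (c * y / 4)" "K\<^sup>2 * (t * y) + K\<^sup>2 * (t * y ^ 3)"] by simp
  qed auto
  also have "\<dots> = (exp (- c * y / 2) * exp (c * y / 4)) * (t * (K * y\<^sup>2 + K\<^sup>2 * y + K\<^sup>2 * y ^ 3))"
    by (simp add: algebra_simps)
  also have "exp (- c * y / 2) * exp (c * y / 4) = exp (- (c / 8) * y) * exp (- (c / 8) * y)"
    by (simp flip: exp_add)
  also have "exp (- (c / 8) * y) * exp (- (c / 8) * y) * (t * (K * y\<^sup>2 + K\<^sup>2 * y + K\<^sup>2 * y ^ 3))
     = (K * (y ^ 2 * exp (- (c / 8) * y)) + K\<^sup>2 * (y ^ 1 * exp (- (c / 8) * y)) + K\<^sup>2 * (y ^ 3 * exp (- (c / 8) * y))) * t * exp (- (c / 8) * y)"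
    by (simp add: algebra_simps)
  also have "\<dots> \<le> (K * (fact 2 / (c / 8) ^ 2) + K\<^sup>2 * (fact 1 / (c / 8) ^ 1) + K\<^sup>2 * (fact 3 / (c / 8) ^ 3)) * t * exp (- (c / 8) * y)"
    using K t c y by (intro mult_right_mono add_mono mult_left_mono power_exp_le) auto
  finally show ?thesis by (simp add: y_def eval_nat_numeral)
qed

text \<open>Once |\<theta>| is at least of order t, the integrand is at most 3 exp(- a / t) and the
  Gaussian at most exp(- a / t), where a = c \<delta>^2 / 2. Together with exp(- a / t) \<le> 3! t^3
  / a^3 this gives 24 = 4 * 3!.\<close>

lemma saddle_far:
  fixes s t \<theta> c \<delta> :: real and z :: complex
  assumes t: "0 < t" and c: "c > 0" and \<delta>: "0 < \<delta>" "\<delta> \<le> 1"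
    and s: "c / t ^ 3 \<le> s" and \<theta>: "\<delta>\<^sup>2 * t\<^sup>2 \<le> \<theta>\<^sup>2"
    and z: "Re z \<le> 1 - c * \<theta>\<^sup>2 / (t * (t\<^sup>2 + \<theta>\<^sup>2))"
  shows "\<bar>Re (exp z) - exp (- s * \<theta>\<^sup>2 / 2)\<bar> \<le> 24 / (c * \<delta>\<^sup>2 / 2) ^ 3 * t ^ 3"
proof -
  define a where "a = c * \<delta>\<^sup>2 / 2"
  have a: "a > 0" using c \<delta> by (simp add: a_def)
  have "\<delta>\<^sup>2 / 2 * (t\<^sup>2 + \<theta>\<^sup>2) \<le> \<theta>\<^sup>2"
  proof -
    have "\<delta>\<^sup>2 * \<theta>\<^sup>2 \<le> 1 * \<theta>\<^sup>2" using \<delta> by (intro mult_right_mono power_le_one) auto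
    thus ?thesis using \<theta> by (simp add: algebra_simps)
  qed
  hence "a * (t\<^sup>2 + \<theta>\<^sup>2) \<le> c * \<theta>\<^sup>2" using c by (simp add: a_def mult_left_mono mult.assoc)
  moreover have "t\<^sup>2 + \<theta>\<^sup>2 > 0" using t by (intro add_pos_nonneg) auto
  ultimately have "a / t \<le> c * \<theta>\<^sup>2 / (t * (t\<^sup>2 + \<theta>\<^sup>2))" using t divide_right_mono[of a "c * \<theta>\<^sup>2 / (t\<^sup>2 + \<theta>\<^sup>2)" t]
    by (simp add: pos_le_divide_eq mult.commute)
  hence "\<bar>Re (exp z)\<bar> \<le> exp (1 - a / t)"
    using z abs_Re_le_cmod[of "exp z"] by (simp add: norm_exp_eq_Re) (meson diff_left_mono exp_le_cancel_iff order_trans)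
  also have "exp (1 - a / t) = exp 1 * exp (- (a / t))" by (simp flip: exp_add)
  also have "\<dots> \<le> 3 * exp (- (a / t))" using exp_le by (intro mult_right_mono) auto
  finally have 1: "\<bar>Re (exp z)\<bar> \<le> 3 * exp (- (a / t))" .
  have "a / t = c / t ^ 3 * (\<delta>\<^sup>2 * t\<^sup>2) / 2" using t by (simp add: a_def eval_nat_numeral)
  also have "\<dots> \<le> s * \<theta>\<^sup>2 / 2"
    using s \<theta> c t order.trans[of 0 "c / t ^ 3" s] by (intro divide_right_mono mult_mono) auto
  finally have 2: "exp (- s * \<theta>\<^sup>2 / 2) \<le> exp (- (a / t))" by simp
  have "(1 / t) ^ 3 * exp (- a * (1 / t)) \<le> fact 3 / a ^ 3" using a t by (intro power_exp_le) auto
  hence "exp (- (a / t)) \<le> 6 / a ^ 3 * t ^ 3" using t a by (simp add: eval_nat_numeral field_simps)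
  moreover have "exp (- s * \<theta>\<^sup>2 / 2) > 0" by simp
  ultimately show ?thesis using 1 2 unfolding a_def[symmetric] by linarith
qed

text \<open>This permits the extension of the Gaussian to the whole line: beyond pi the scaled
  variable y exceeds 1 / t, and half of the decay is traded for a factor t.\<close>

lemma saddle_outside:
  fixes s t \<theta> c :: real
  assumes t: "0 < t" "t \<le> 1" and c: "c > 0" and s: "c / t ^ 3 \<le> s" and \<theta>: "pi < \<bar>\<theta>\<bar>"
  shows "exp (- s * \<theta>\<^sup>2 / 2) \<le> 4 / c * t * exp (- (c / 8) * (\<theta>\<^sup>2 / t ^ 3))"
proof -
  define y where "y = \<theta>\<^sup>2 / t ^ 3"
  have "1 \<le> \<theta>\<^sup>2" using \<theta> pi_gt3 by (metis abs_le_square_iff abs_one less_eq_real_def order.strict_trans1 one_power2 power2_abs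
    linorder_not_less numeral_One one_less_numeral_iff order.strict_trans semiring_norm(77))
  moreover have "t ^ 3 \<le> t" using t power_decreasing[of 1 3 t] by simp
  ultimately have y: "1 / t \<le> y" unfolding y_def using t by (intro frac_le) auto
  have y0: "y > 0" using y t by (meson order.strict_trans2 zero_less_divide_1_iff)
  have "exp (- s * \<theta>\<^sup>2 / 2) \<le> exp (- c * y / 2)"
    using mult_right_mono[OF s, of "\<theta>\<^sup>2"] by (simp add: y_def)
  also have "\<dots> \<le> exp (- (c / 4) * y) * exp (- (c / 8) * y)" using c y0 by (simp flip: exp_add)
  also have "exp (- (c / 4) * y) \<le> 4 / c * t"
  proof -
    have "y ^ 1 * exp (- (c / 4) * y) \<le> fact 1 / (c / 4) ^ 1" using c y0 by (intro power_exp_le) auto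
    hence "exp (- (c / 4) * y) \<le> 4 / c * (1 / y)" using y0 c by (simp add: field_simps)
    also have "1 / y \<le> t" using y y0 t by (simp add: field_simps)
    hence "4 / c * (1 / y) \<le> 4 / c * t" using c by (intro mult_left_mono) auto
    finally show ?thesis .
  qed
  finally show ?thesis by (simp add: y_def)
qed

text \<open>The powers of t in the hypotheses are the sizes of the moments. The constant depends on
  c and K only. When s has exact order 1 / t^3, the main term has order t^(3/2), so the error
  t^(5/2) is a relative error of order t.\<close>

lemma saddle_point_integral:
  fixes c K :: real
  assumes c: "c > 0" and K: "K > 0"
  obtains C where "C > 0" and "\<And>t b s \<kappa> q z.
    \<lbrakk>0 < t; t \<le> 1; \<bar>b\<bar> \<le> K / t; c / t ^ 3 \<le> s; \<bar>\<kappa>\<bar> \<le> K / t ^ 4; 0 \<le> q; q \<le> K / t ^ 5;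
     continuous_on {-pi..pi} (\<lambda>\<theta>. exp (z \<theta>) :: complex);
     \<And>\<theta>. norm (z \<theta> - Complex (- s * \<theta>\<^sup>2 / 2) (b * \<theta> + \<kappa> * \<theta> ^ 3)) \<le> q * \<theta> ^ 4;
     \<And>\<theta>. \<bar>\<theta>\<bar> \<le> pi \<Longrightarrow> Re (z \<theta>) \<le> 1 - c * \<theta>\<^sup>2 / (t * (t\<^sup>2 + \<theta>\<^sup>2))\<rbrakk>
    \<Longrightarrow> \<bar>Re (integral {-pi..pi} (\<lambda>\<theta>. exp (z \<theta>))) - sqrt (2 * pi / s)\<bar> \<le> C * (t\<^sup>2 * sqrt t)"
proof -
  \<comment> \<open>The second entry ensures K \<delta>^2 \<le> c / 4, so that
    \<open>saddle_near\<close> applies for |\<theta>| \<le> \<delta> t; the cap at 1 is for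
    \<open>saddle_far\<close>.\<close>
  define \<delta> where "\<delta> = min 1 (sqrt (c / (4 * K)))"
  have \<delta>: "0 < \<delta>" "\<delta> \<le> 1" using c K by (auto simp: \<delta>_def)
  have "\<delta>\<^sup>2 \<le> (sqrt (c / (4 * K)))\<^sup>2" using \<delta> by (intro power_mono) (auto simp: \<delta>_def)
  hence \<delta>2: "K * \<delta>\<^sup>2 \<le> c / 4" using c K by (simp add: field_simps)
  define C1 where "C1 = K * (2 / (c / 8)\<^sup>2) + K\<^sup>2 * (1 / (c / 8)) + K\<^sup>2 * (6 / (c / 8) ^ 3) + 4 / c"
  define C2 where "C2 = 24 / (c * \<delta>\<^sup>2 / 2) ^ 3"
  have C12: "C1 > 0" "C2 > 0" using c K \<delta> by (auto simp: C1_def C2_def intro!: add_pos_pos mult_pos_pos divide_pos_pos)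
  define C where "C = C1 * sqrt (8 * pi / c) + C2 * (2 * pi)"
  show ?thesis
  proof (rule that[of C])
    show "C > 0" using C12 c by (auto simp: C_def intro!: add_pos_pos mult_pos_pos)
    fix t b s \<kappa> q :: real and z :: "real \<Rightarrow> complex"
    assume t: "0 < t" "t \<le> 1" and b: "\<bar>b\<bar> \<le> K / t" and s: "c / t ^ 3 \<le> s"
      and \<kappa>: "\<bar>\<kappa>\<bar> \<le> K / t ^ 4" and q: "0 \<le> q" "q \<le> K / t ^ 5"
      and cont: "continuous_on {-pi..pi} (\<lambda>\<theta>. exp (z \<theta>))"
      and z: "\<And>\<theta>. norm (z \<theta> - Complex (- s * \<theta>\<^sup>2 / 2) (b * \<theta> + \<kappa> * \<theta> ^ 3)) \<le> q * \<theta> ^ 4"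
      and Re_z: "\<And>\<theta>. \<bar>\<theta>\<bar> \<le> pi \<Longrightarrow> Re (z \<theta>) \<le> 1 - c * \<theta>\<^sup>2 / (t * (t\<^sup>2 + \<theta>\<^sup>2))"
    have s0: "s > 0" using s c t by (meson divide_pos_pos order.strict_trans2 zero_less_power)
    define E where "E \<theta> = exp (- (c / 8) * (\<theta>\<^sup>2 / t ^ 3))" for \<theta> :: real
    define f where "f \<theta> = indicator {-pi..pi} \<theta> *\<^sub>R Re (exp (z \<theta>))" for \<theta>
    define g where "g \<theta> = exp (- s * \<theta>\<^sup>2 / 2)" for \<theta> :: real
    \<comment> \<open>A majorant of |f - g| on the whole line. Its first summand integrates to order
      t * t^(3/2), its second to order t^3, which is smaller.\<close>
    define h where "h \<theta> = C1 * t * E \<theta> + C2 * t ^ 3 * indicator {-pi..pi} \<theta>" for \<theta> :: real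
    have E0: "E \<theta> \<ge> 0" for \<theta> by (simp add: E_def)
    have bound: "\<bar>f \<theta> - g \<theta>\<bar> \<le> h \<theta>" for \<theta>
    proof (cases "\<bar>\<theta>\<bar> \<le> pi")
      case False
      hence "g \<theta> \<le> 4 / c * t * E \<theta>"
        unfolding g_def E_def using t c s by (intro saddle_outside) auto
      also have "\<dots> \<le> C1 * t * E \<theta>" using t c K E0
        by (intro mult_right_mono) (auto simp: C1_def)
      finally have "g \<theta> \<le> C1 * t * E \<theta>" .
      moreover have "g \<theta> \<ge> 0" "\<theta> \<notin> {-pi..pi}" using False by (auto simp: g_def)
      ultimately show ?thesis by (simp add: f_def h_def)
    next
      case True
      have *: "\<bar>Re (exp (z \<theta>)) - g \<theta>\<bar> \<le> C1 * t * E \<theta> + C2 * t ^ 3"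
      proof (cases "\<theta>\<^sup>2 \<le> \<delta>\<^sup>2 * t\<^sup>2")
        case True
        have "K * \<theta>\<^sup>2 \<le> K * (\<delta>\<^sup>2 * t\<^sup>2)" using True K by (intro mult_left_mono) auto
        also have "\<dots> \<le> c / 4 * t\<^sup>2" using mult_right_mono[OF \<delta>2, of "t\<^sup>2"] by (simp add: mult_ac)
        finally have "K * \<theta>\<^sup>2 \<le> c / 4 * t\<^sup>2" .
        from saddle_near[OF t c K b s \<kappa> q z this]
        have "\<bar>Re (exp (z \<theta>)) - g \<theta>\<bar> \<le> (C1 - 4 / c) * t * E \<theta>" by (simp add: g_def E_def C1_def)
        also have "\<dots> \<le> C1 * t * E \<theta>" using t c E0 by (intro mult_right_mono) auto
        also have "\<dots> \<le> C1 * t * E \<theta> + C2 * t ^ 3" using C12 t by simp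
        finally show ?thesis .
      next
        case False
        have "\<bar>Re (exp (z \<theta>)) - g \<theta>\<bar> \<le> C2 * t ^ 3"
          unfolding g_def C2_def using False \<open>\<bar>\<theta>\<bar> \<le> pi\<close>
          by (intro saddle_far[OF t(1) c \<delta> s _ Re_z]) auto
        also have "\<dots> \<le> C1 * t * E \<theta> + C2 * t ^ 3" using C12 t E0 by simp
        finally show ?thesis .
      qed
      have "\<theta> \<in> {-pi..pi}" using True by (auto simp: abs_le_iff)
      thus ?thesis using * by (simp add: f_def h_def)
    qed
    have cont': "continuous_on {-pi..pi} (\<lambda>\<theta>. Re (exp (z \<theta>)))" by (intro continuous_intros cont)
    have set_int: "set_integrable lborel {-pi..pi} (\<lambda>\<theta>. Re (exp (z \<theta>)))"
      using cont' by (intro borel_integrable_atLeastAtMost') auto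
    have int_f: "integrable lborel f" using set_int by (simp add: set_integrable_def f_def[abs_def])
    have "(LINT \<theta>|lborel. f \<theta>) = integral {-pi..pi} (\<lambda>\<theta>. Re (exp (z \<theta>)))"
      using set_borel_integral_eq_integral(2)[OF set_int] by (simp add: set_lebesgue_integral_def f_def)
    also have "\<dots> = Re (integral {-pi..pi} (\<lambda>\<theta>. exp (z \<theta>)))"
      using integral_linear[OF integrable_continuous_real[OF cont] bounded_linear_Re] by (simp add: o_def)
    finally have If: "(LINT \<theta>|lborel. f \<theta>) = Re (integral {-pi..pi} (\<lambda>\<theta>. exp (z \<theta>)))" .
    have g_eq: "g = (\<lambda>\<theta>. exp (- (s / 2) * \<theta>\<^sup>2))" by (auto simp: g_def)
    have int_g: "integrable lborel g" and Ig: "(LINT \<theta>|lborel. g \<theta>) = sqrt (2 * pi / s)"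
      unfolding g_eq using gaussian_integral[of "s / 2"] s0 by (simp_all add: mult.commute)
    define a where "a = c / (8 * t ^ 3)"
    have a: "a > 0" using c t by (simp add: a_def)
    have E_eq: "E = (\<lambda>\<theta>. exp (- a * \<theta>\<^sup>2))" by (auto simp: E_def a_def)
    have int_E: "integrable lborel E" and IE: "(LINT \<theta>|lborel. E \<theta>) = sqrt (pi / a)"
      unfolding E_eq by (rule gaussian_integral[OF a])+
    have "sqrt (pi / a) = sqrt (8 * pi / c) * (t * sqrt t)"
    proof -
      have "pi / a = (8 * pi / c) * (t\<^sup>2 * t)" using t c by (simp add: a_def eval_nat_numeral)
      hence "sqrt (pi / a) = sqrt (8 * pi / c) * sqrt (t\<^sup>2 * t)" by (simp only: real_sqrt_mult)
      thus ?thesis using t by (simp add: real_sqrt_mult)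
    qed
    have int_ind: "integrable lborel (\<lambda>\<theta>. indicator {-pi..pi} \<theta> :: real)"
      by (simp add: integrable_indicator_iff)
    have int_h: "integrable lborel h" unfolding h_def[abs_def]
      by (intro Bochner_Integration.integrable_add integrable_mult_right int_E int_ind)
    have Ih: "(LINT \<theta>|lborel. h \<theta>) = C1 * t * sqrt (pi / a) + C2 * t ^ 3 * (2 * pi)"
      unfolding h_def using int_E int_ind IE by simp
    have "\<bar>(LINT \<theta>|lborel. f \<theta> - g \<theta>)\<bar> \<le> (LINT \<theta>|lborel. h \<theta>)"
      using int_f int_g int_h bound
      by (intro integral_abs_bound_integral Bochner_Integration.integrable_diff) auto
    also have "(LINT \<theta>|lborel. f \<theta> - g \<theta>) = Re (integral {-pi..pi} (\<lambda>\<theta>. exp (z \<theta>))) - sqrt (2 * pi / s)"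
      using int_f int_g by (simp add: If Ig)
    also note Ih
    also have "C1 * t * sqrt (pi / a) + C2 * t ^ 3 * (2 * pi) \<le> C * (t\<^sup>2 * sqrt t)"
    proof -
      have "t \<le> sqrt t" using t real_le_rsqrt[of t t] by (simp add: power2_eq_square mult_le_one mult_left_le)
      hence "t\<^sup>2 * t \<le> t\<^sup>2 * sqrt t" by (intro mult_left_mono) auto
      hence "C2 * t ^ 3 * (2 * pi) \<le> C2 * (t\<^sup>2 * sqrt t) * (2 * pi)"
        using C12 by (intro mult_right_mono mult_left_mono) (auto simp: eval_nat_numeral)
      thus ?thesis unfolding \<open>sqrt (pi / a) = _\<close> C_def by (simp add: algebra_simps power2_eq_square)
    qed
    finally show "\<bar>Re (integral {-pi..pi} (\<lambda>\<theta>. exp (z \<theta>))) - sqrt (2 * pi / s)\<bar> \<le> C * (t\<^sup>2 * sqrt t)" .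
  qed
qed

subsection \<open>The logarithm of the partition product\<close>

text \<open>The logarithm of the factor with index k + 1 at angle \<theta>, minus its logarithm at
  angle 0, which is the real number \<open>moment_row 0 t k\<close>.\<close>

definition log_ratio_term :: "real \<Rightarrow> real \<Rightarrow> nat \<Rightarrow> complex" where
  "log_ratio_term t \<theta> k =
     (\<Sum>m. of_real (moment_term 0 t k m) * (iexp (- (real (Suc k) * real (Suc m) * \<theta>)) - 1))"

lemma summable_log_ratio:
  assumes t: "t > 0"
  shows "summable (\<lambda>m. complex_of_real (moment_term 0 t k m) * (iexp (- (real (Suc k) * real (Suc m) * \<theta>)) - 1))"
proof (rule summable_comparison_test')
  show "summable (\<lambda>m. 2 * moment_term 0 t k m)" using t by (intro summable_mult summable_moment_term)
  fix m
  have "norm (iexp (- (real (Suc k) * real (Suc m) * \<theta>)) - 1) \<le> 1 + 1"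
    by (rule order.trans[OF norm_triangle_ineq4]) (simp add: norm_exp_eq_Re)
  hence "norm (iexp (- (real (Suc k) * real (Suc m) * \<theta>)) - 1) * moment_term 0 t k m \<le> 2 * moment_term 0 t k m"
    by (intro mult_right_mono moment_term_nonneg) auto
  thus "norm (complex_of_real (moment_term 0 t k m) * (iexp (- (real (Suc k) * real (Suc m) * \<theta>)) - 1)) \<le> 2 * moment_term 0 t k m"
    by (simp add: norm_mult moment_term_nonneg mult.commute del: of_nat_Suc)
qed

text \<open>The logarithm series is used inside the unit disc and the result is exponentiated, so no
  branch has to be tracked when factors are multiplied.\<close>

lemma partition_factor_eq:
  assumes t: "t > 0"
  shows "1 / (1 - exp (- of_nat (Suc k) * Complex t \<theta>)) =
     exp (of_real (moment_row 0 t k) + log_ratio_term t \<theta> k)"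
proof -
  define z where "z = exp (- of_nat (Suc k) * Complex t \<theta>)"
  have nz: "1 - z \<noteq> 0" unfolding z_def by (rule one_minus_exp_nonzero[OF t])
  have "norm z < 1" unfolding z_def using t by (simp add: norm_exp_eq_Re mult_pos_pos del: of_nat_Suc)
  hence "(\<lambda>n. - (- ((- (- z)) ^ n) / of_nat n)) sums (- ln (1 + - z))"
    using sums_minus[OF Ln_series'[of "-z"]] by simp
  hence "(\<lambda>n. z ^ n / of_nat n) sums (- ln (1 - z))" by simp
  hence s: "(\<lambda>n. z ^ Suc n / of_nat (Suc n)) sums (- ln (1 - z))"
    by (subst sums_Suc_iff) simp
  have eq: "z ^ Suc m / of_nat (Suc m) = of_real (moment_term 0 t k m) +
      of_real (moment_term 0 t k m) * (iexp (- (real (Suc k) * real (Suc m) * \<theta>)) - 1)" for m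
  proof -
    have "z ^ Suc m = exp (of_nat (Suc m) * (- of_nat (Suc k) * Complex t \<theta>))"
      unfolding z_def by (rule exp_of_nat_mult[symmetric])
    also have "of_nat (Suc m) * (- of_nat (Suc k) * Complex t \<theta>) =
       of_real (- t * (real (Suc k) * real (Suc m))) + \<i> * of_real (- (real (Suc k) * real (Suc m) * \<theta>))"
      by (simp add: Complex_eq algebra_simps)
    also have "exp \<dots> = of_real (exp (- t * (real (Suc k) * real (Suc m)))) * iexp (- (real (Suc k) * real (Suc m) * \<theta>))"
      by (simp only: exp_add exp_of_real)
    finally show ?thesis
      by (simp add: moment_term_def right_diff_distrib del: of_nat_Suc)
  qed
  have "(\<lambda>m. of_real (moment_term 0 t k m) +
      of_real (moment_term 0 t k m) * (iexp (- (real (Suc k) * real (Suc m) * \<theta>)) - 1)) sums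
      (of_real (moment_row 0 t k) + log_ratio_term t \<theta> k)"
    unfolding log_ratio_term_def moment_row_def
    by (intro sums_add summable_sums summable_log_ratio t sums_of_real summable_moment_term)
  hence "of_real (moment_row 0 t k) + log_ratio_term t \<theta> k = - ln (1 - z)"
    using s unfolding eq by (rule sums_unique2)
  thus ?thesis using nz by (simp add: exp_minus inverse_eq_divide z_def)
qed

text \<open>Each oscillating exponential is expanded with the Taylor remainder y^4 / 24, which is
  valid for all real y. Hence the bound holds for every \<theta>, and the coefficients are the rows
  of the moments of order 1 to 4.\<close>

lemma log_ratio_term_taylor:
  assumes t: "t > 0"
  shows "norm (log_ratio_term t \<theta> k - Complex (- moment_row 2 t k * \<theta>\<^sup>2 / 2)
      (- moment_row 1 t k * \<theta> + moment_row 3 t k / 6 * \<theta> ^ 3)) \<le> moment_row 4 t k / 24 * \<theta> ^ 4"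
proof -
  define x where "x m = real (Suc k) * real (Suc m)" for m
  define d where "d m = of_real (moment_term 0 t k m) * (iexp (- (x m * \<theta>)) - 1)
     - Complex (- moment_term 2 t k m * \<theta>\<^sup>2 / 2) (- moment_term 1 t k m * \<theta> + moment_term 3 t k m / 6 * \<theta> ^ 3)" for m
  have mt: "moment_term j t k m = moment_term 0 t k m * x m ^ j" for j m
    by (simp add: moment_term_def x_def)
  have le: "norm (d m) \<le> moment_term 4 t k m / 24 * \<theta> ^ 4" for m
  proof -
    define y where "y = x m * \<theta>"
    have "cmod (iexp (- y) - (\<Sum>j\<le>3. (\<i> * of_real (- y)) ^ j / fact j)) \<le> \<bar>- y\<bar> ^ Suc 3 / fact (Suc 3)"
      by (rule iexp_approx1)
    also have "(\<Sum>j\<le>3. (\<i> * of_real (- y)) ^ j / fact j) = 1 + Complex (- y\<^sup>2 / 2) (- y + y ^ 3 / 6)"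
      by (simp add: eval_nat_numeral complex_eq_iff)
    also have "\<bar>- y\<bar> ^ Suc 3 / fact (Suc 3) = y ^ 4 / 24" by (simp add: eval_nat_numeral)
    finally have "cmod (iexp (- y) - (1 + Complex (- y\<^sup>2 / 2) (- y + y ^ 3 / 6))) \<le> y ^ 4 / 24" .
    hence "moment_term 0 t k m * cmod (iexp (- y) - (1 + Complex (- y\<^sup>2 / 2) (- y + y ^ 3 / 6)))
        \<le> moment_term 0 t k m * (y ^ 4 / 24)" by (intro mult_left_mono moment_term_nonneg)
    also have "moment_term 0 t k m * cmod (iexp (- y) - (1 + Complex (- y\<^sup>2 / 2) (- y + y ^ 3 / 6)))
       = cmod (of_real (moment_term 0 t k m) * (iexp (- y) - (1 + Complex (- y\<^sup>2 / 2) (- y + y ^ 3 / 6))))"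
      by (simp add: norm_mult moment_term_nonneg)
    also have "of_real (moment_term 0 t k m) * (iexp (- y) - (1 + Complex (- y\<^sup>2 / 2) (- y + y ^ 3 / 6))) = d m"
      unfolding d_def mt[of 1] mt[of 2] mt[of 3] y_def[symmetric]
      by (simp add: complex_eq_iff y_def power_mult_distrib algebra_simps)
    finally show ?thesis unfolding mt[of 4] by (simp add: y_def power_mult_distrib)
  qed
  have sm: "moment_term j t k sums moment_row j t k" for j
    unfolding moment_row_def by (intro summable_sums summable_moment_term t)
  have "(\<lambda>m. of_real (- moment_term 2 t k m * \<theta>\<^sup>2 / 2) +
        \<i> * of_real (- moment_term 1 t k m * \<theta> + moment_term 3 t k m / 6 * \<theta> ^ 3)) sums
      (of_real (- moment_row 2 t k * \<theta>\<^sup>2 / 2) + \<i> * of_real (- moment_row 1 t k * \<theta> + moment_row 3 t k / 6 * \<theta> ^ 3))"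
    by (intro sums_add sums_mult sums_of_real sums_divide sums_mult2 sums_minus sm)
  hence "(\<lambda>m. Complex (- moment_term 2 t k m * \<theta>\<^sup>2 / 2) (- moment_term 1 t k m * \<theta> + moment_term 3 t k m / 6 * \<theta> ^ 3)) sums
      Complex (- moment_row 2 t k * \<theta>\<^sup>2 / 2) (- moment_row 1 t k * \<theta> + moment_row 3 t k / 6 * \<theta> ^ 3)"
    unfolding Complex_eq .
  with summable_sums[OF summable_log_ratio[OF t, of k \<theta>]]
  have "d sums (log_ratio_term t \<theta> k - Complex (- moment_row 2 t k * \<theta>\<^sup>2 / 2)
      (- moment_row 1 t k * \<theta> + moment_row 3 t k / 6 * \<theta> ^ 3))"
    unfolding d_def[abs_def] x_def log_ratio_term_def by (rule sums_diff)
  moreover have s4: "(\<lambda>m. moment_term 4 t k m / 24 * \<theta> ^ 4) sums (moment_row 4 t k / 24 * \<theta> ^ 4)"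
    by (intro sums_divide sums_mult2 sm)
  moreover have "norm (\<Sum>m. d m) \<le> (\<Sum>m. moment_term 4 t k m / 24 * \<theta> ^ 4)"
    by (rule norm_suminf_le[OF le sums_summable[OF s4]])
  ultimately show ?thesis by (simp only: sums_iff)
qed

text \<open>Only the term \<open>m = 1\<close> of the logarithm is kept: its sum over \<open>k\<close> is geometric.\<close>

lemma Re_log_ratio_term_le:
  assumes t: "t > 0"
  shows "Re (log_ratio_term t \<theta> k) \<le> exp (- t * real (Suc k)) * (cos (real (Suc k) * \<theta>) - 1)"
proof -
  define f where "f m = moment_term 0 t k m * (1 - cos (real (Suc k) * real (Suc m) * \<theta>))" for m
  have "(\<lambda>m. Re (of_real (moment_term 0 t k m) * (iexp (- (real (Suc k) * real (Suc m) * \<theta>)) - 1)))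
      sums Re (log_ratio_term t \<theta> k)"
    unfolding log_ratio_term_def by (intro sums_Re summable_sums summable_log_ratio t)
  hence "(\<lambda>m. - f m) sums Re (log_ratio_term t \<theta> k)"
    by (simp add: f_def Re_exp algebra_simps del: of_nat_Suc)
  from sums_minus[OF this] have s: "f sums (- Re (log_ratio_term t \<theta> k))" by simp
  have "f m \<ge> 0" for m unfolding f_def by (intro mult_nonneg_nonneg moment_term_nonneg) simp
  hence "(\<Sum>m\<in>{0}. f m) \<le> (\<Sum>m. f m)" using s by (intro sum_le_suminf) (auto simp: sums_iff)
  hence "f 0 \<le> - Re (log_ratio_term t \<theta> k)" using s by (simp add: sums_iff)
  thus ?thesis by (simp add: f_def moment_term_def algebra_simps)
qed

text \<open>The sum is 1 / (1 - r) - Re (1 / (1 - z)) for z = r exp(i \<theta>). With a = 1 - r and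
  v = 2 r (1 - cos \<theta>) one has |1 - z|^2 = a^2 + v, and the sum becomes v (1 - a / 2) / (a
  (a^2 + v)).\<close>

lemma cos_geometric_lower_bound:
  fixes t \<theta> :: real
  assumes t: "0 < t" "t \<le> 1 / 2" and \<theta>: "\<bar>\<theta>\<bar> \<le> pi"
  obtains B where "(\<lambda>k. exp (- t * real (Suc k)) * (1 - cos (real (Suc k) * \<theta>))) sums B"
    and "B \<ge> \<theta>\<^sup>2 / (32 * (t * (t\<^sup>2 + \<theta>\<^sup>2)))"
proof -
  define r where "r = exp (- t)"
  have "1 - t \<le> r" using exp_ge_add_one_self[of "-t"] by (simp add: r_def)
  hence r: "1 / 2 \<le> r" "r < 1" "0 < 1 - r" "1 - r \<le> t" using t by (auto simp: r_def)
  define a where "a = 1 - r"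
  define v where "v = 2 * r * (1 - cos \<theta>)"
  define z where "z = of_real r * iexp \<theta>"
  have nz: "norm z = r" using r by (simp add: z_def norm_mult)
  have pw: "z ^ Suc k = of_real (exp (- t * real (Suc k))) * iexp (real (Suc k) * \<theta>)" for k
    unfolding z_def r_def power_mult_distrib exp_of_nat_mult[symmetric] of_real_power[symmetric]
    by (simp add: mult_ac del: of_nat_Suc power_Suc)
  have "(\<lambda>k. z * z ^ k) sums (z * (1 / (1 - z)))"
    using nz r by (intro sums_mult geometric_sums) auto
  hence zs: "(\<lambda>k. Re (z ^ Suc k)) sums Re (z / (1 - z))"
    using sums_Re by (fastforce simp: power_Suc)
  have rs: "(\<lambda>k. exp (- t * real (Suc k))) sums (1 / (exp t - 1))"
    using t by (intro geometric_exp_sums) auto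
  define B where "B = 1 / (exp t - 1) - Re (z / (1 - z))"
  show ?thesis
  proof (rule that[of B])
    show "(\<lambda>k. exp (- t * real (Suc k)) * (1 - cos (real (Suc k) * \<theta>))) sums B"
      using sums_diff[OF rs zs] unfolding pw
      by (simp add: B_def Re_exp right_diff_distrib del: of_nat_Suc)
    have rt: "1 / (exp t - 1) = 1 / a - 1"
      using r t by (simp add: a_def r_def exp_minus field_simps)
    have a: "a > 0" "a \<le> t" "a \<le> 1 / 2" using r by (auto simp: a_def)
    have v: "v \<ge> 0" using r by (simp add: v_def)
    have zne: "1 - z \<noteq> 0" using nz r by auto
    have Re1: "Re (1 - z) = a + v / 2" by (simp add: z_def a_def v_def Re_exp field_simps)
    have "(cmod (1 - z))\<^sup>2 = (1 - r * cos \<theta>)\<^sup>2 + (r * sin \<theta>)\<^sup>2"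
      by (simp add: cmod_power2 z_def Re_exp Im_exp)
    also have "\<dots> = 1 - 2 * r * cos \<theta> + r\<^sup>2 * ((cos \<theta>)\<^sup>2 + (sin \<theta>)\<^sup>2)"
      unfolding distrib_left by (simp add: power2_eq_square algebra_simps)
    also have "\<dots> = 1 - 2 * r * cos \<theta> + r\<^sup>2" by simp
    also have "\<dots> = a\<^sup>2 + v" by (simp add: a_def v_def power2_eq_square algebra_simps)
    finally have n2: "(cmod (1 - z))\<^sup>2 = a\<^sup>2 + v" .
    have "z / (1 - z) = 1 / (1 - z) - 1" using zne by (simp add: field_simps)
    hence "Re (z / (1 - z)) = Re (1 / (1 - z)) - 1" by simp
    also have "Re (1 / (1 - z)) = (a + v / 2) / (a\<^sup>2 + v)"
      using Re1 n2 by (simp add: Re_divide cmod_power2)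
    finally have "B = 1 / a - (a + v / 2) / (a\<^sup>2 + v)" unfolding B_def rt by simp
    also have "\<dots> = v * (1 - a / 2) / (a * (a\<^sup>2 + v))"
    proof -
      have "a\<^sup>2 + v > 0" using a v by (simp add: add_pos_nonneg)
      hence "1 / a - (a + v / 2) / (a\<^sup>2 + v) = (1 * (a\<^sup>2 + v) - (a + v / 2) * a) / (a * (a\<^sup>2 + v))"
        using a by (intro diff_frac_eq) auto
      also have "1 * (a\<^sup>2 + v) - (a + v / 2) * a = v * (1 - a / 2)"
        by (simp add: power2_eq_square algebra_simps)
      finally show ?thesis .
    qed
    finally have B: "B = v * (1 - a / 2) / (a * (a\<^sup>2 + v))" .
    \<comment> \<open>From 1 - cos \<theta> \<ge> \<theta>^2 / 2 - \<theta>^4 / 24 and \<theta>^2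
      \<le> pi^2 \<le> 10 the quotient by \<theta>^2 is at least 1 / 12; the factor 2 r is at least
      1.\<close>
    have v_ge: "v \<ge> \<theta>\<^sup>2 / 16"
    proof -
      have "cmod (iexp \<theta> - (\<Sum>j\<le>3. (\<i> * of_real \<theta>) ^ j / fact j)) \<le> \<bar>\<theta>\<bar> ^ Suc 3 / fact (Suc 3)"
        by (rule iexp_approx1)
      moreover have "Re (iexp \<theta> - (\<Sum>j\<le>3. (\<i> * of_real \<theta>) ^ j / fact j)) = cos \<theta> - 1 + \<theta>\<^sup>2 / 2"
        by (simp add: eval_nat_numeral Re_exp)
      moreover have "\<bar>\<theta>\<bar> ^ Suc 3 / fact (Suc 3) = \<theta>\<^sup>2 * \<theta>\<^sup>2 / 24" by (simp add: eval_nat_numeral)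
      ultimately have "cos \<theta> - 1 + \<theta>\<^sup>2 / 2 \<le> \<theta>\<^sup>2 * \<theta>\<^sup>2 / 24"
        using complex_Re_le_cmod[of "iexp \<theta> - (\<Sum>j\<le>3. (\<i> * of_real \<theta>) ^ j / fact j)"] by linarith
      moreover have "\<theta>\<^sup>2 * \<theta>\<^sup>2 \<le> \<theta>\<^sup>2 * 10"
      proof (intro mult_left_mono)
        have "\<theta>\<^sup>2 \<le> pi\<^sup>2" using power_mono[OF \<theta>, of 2] by simp
        also have "pi \<le> 3.16" using pi_approx by simp
        hence "pi\<^sup>2 \<le> 3.16\<^sup>2" using pi_gt_zero by (intro power_mono) auto
        also have "(3.16\<^sup>2 :: real) \<le> 10" by (simp add: power2_eq_square)
        finally show "\<theta>\<^sup>2 \<le> 10" by simp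
      qed auto
      ultimately have "1 - cos \<theta> \<ge> \<theta>\<^sup>2 / 16"
        using zero_le_power2[of \<theta>] by linarith
      moreover have "1 * (1 - cos \<theta>) \<le> 2 * r * (1 - cos \<theta>)" using r by (intro mult_right_mono) auto
      ultimately show ?thesis by (simp add: v_def)
    qed
    have "\<theta>\<^sup>2 / (32 * (t * (t\<^sup>2 + \<theta>\<^sup>2))) = (1 / (2 * t)) * ((\<theta>\<^sup>2 / 16) / (t\<^sup>2 + \<theta>\<^sup>2))"
      by (simp add: mult_ac)
    \<comment> \<open>The quotient v / (a^2 + v) increases with v and decreases with a, so v may be
      lowered to \<theta>^2 / 16 and a raised to t. The factor 1 / 2 bounds 1 - a / 2 from below,
      and 32 = 2 * 16.\<close>
    also have "\<dots> \<le> (1 / (2 * a)) * (v / (a\<^sup>2 + v))"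
    proof (rule mult_mono)
      show "1 / (2 * t) \<le> 1 / (2 * a)" using a t by (intro divide_left_mono) auto
      define w where "w = \<theta>\<^sup>2 / 16"
      have w: "0 \<le> w" "w \<le> v" using v_ge by (auto simp: w_def)
      have "a\<^sup>2 \<le> t\<^sup>2" using a by (intro power_mono) auto
      have t2: "t\<^sup>2 > 0" "a\<^sup>2 > 0" using t a by auto
      have "w / (t\<^sup>2 + \<theta>\<^sup>2) \<le> w / (a\<^sup>2 + w)"
        using w t2 \<open>a\<^sup>2 \<le> t\<^sup>2\<close> by (intro divide_left_mono add_mono mult_pos_pos) (auto simp: w_def add_pos_nonneg)
      also have "\<dots> \<le> v / (a\<^sup>2 + v)"
      proof -
        have pos: "0 < a\<^sup>2 + w" "0 < a\<^sup>2 + v" using w v t2 by (auto intro: add_pos_nonneg)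
        have "x / (a\<^sup>2 + x) = 1 - a\<^sup>2 / (a\<^sup>2 + x)" if "0 < a\<^sup>2 + x" for x
          using that by (simp add: diff_divide_eq_iff[of "a\<^sup>2 + x" 1] del: zero_less_power2)
        moreover have "a\<^sup>2 / (a\<^sup>2 + v) \<le> a\<^sup>2 / (a\<^sup>2 + w)"
          using pos w by (intro divide_left_mono) auto
        ultimately show ?thesis using pos by simp
      qed
      finally show "(\<theta>\<^sup>2 / 16) / (t\<^sup>2 + \<theta>\<^sup>2) \<le> v / (a\<^sup>2 + v)" by (simp add: w_def)
    qed (use a v t in auto)
    also have "\<dots> = v * (1 / 2) / (a * (a\<^sup>2 + v))" by (simp add: mult_ac)
    also have "\<dots> \<le> B" unfolding B using a v
      by (intro divide_right_mono mult_left_mono) auto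
    finally show "B \<ge> \<theta>\<^sup>2 / (32 * (t * (t\<^sup>2 + \<theta>\<^sup>2)))" .
  qed
qed

subsection \<open>The Hardy--Ramanujan formula with a rate\<close>

lemma partition_prod_eq_exp:
  assumes "t > 0"
  shows "partition_prod N t \<theta> =
    exp (of_real (\<Sum>k<N. moment_row 0 t k) + (\<Sum>k<N. log_ratio_term t \<theta> k))"
  unfolding partition_prod_def partition_factor_eq[OF assms]
  by (simp add: exp_sum[symmetric] sum.distrib)

lemma sum_log_ratio_taylor:
  assumes t: "t > 0"
  defines "M j N \<equiv> \<Sum>k<N. moment_row j t k"
  shows "norm ((\<Sum>k<N. log_ratio_term t \<theta> k) - Complex (- M 2 N * \<theta>\<^sup>2 / 2)
      (- M 1 N * \<theta> + M 3 N / 6 * \<theta> ^ 3)) \<le> M 4 N / 24 * \<theta> ^ 4"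
proof -
  have "Complex (- M 2 N * \<theta>\<^sup>2 / 2) (- M 1 N * \<theta> + M 3 N / 6 * \<theta> ^ 3) =
     (\<Sum>k<N. Complex (- moment_row 2 t k * \<theta>\<^sup>2 / 2) (- moment_row 1 t k * \<theta> + moment_row 3 t k / 6 * \<theta> ^ 3))"
    by (simp add: complex_eq_iff M_def sum.distrib sum_distrib_right sum_divide_distrib sum_negf sum_subtractf)
  hence "(\<Sum>k<N. log_ratio_term t \<theta> k) - Complex (- M 2 N * \<theta>\<^sup>2 / 2)
      (- M 1 N * \<theta> + M 3 N / 6 * \<theta> ^ 3) = (\<Sum>k<N. log_ratio_term t \<theta> k -
      Complex (- moment_row 2 t k * \<theta>\<^sup>2 / 2) (- moment_row 1 t k * \<theta> + moment_row 3 t k / 6 * \<theta> ^ 3))"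
    by (simp only: sum_subtractf)
  also have "norm \<dots> \<le> (\<Sum>k<N. moment_row 4 t k / 24 * \<theta> ^ 4)"
    by (rule sum_norm_le) (rule log_ratio_term_taylor[OF t])
  also have "\<dots> = M 4 N / 24 * \<theta> ^ 4" by (simp add: M_def sum_distrib_right sum_divide_distrib)
  finally show ?thesis .
qed

text \<open>Cutting the series off at N loses at most twice the geometric tail, that is at most 1.
  This is the origin of the leading 1 in the decay hypothesis of the saddle point estimate.\<close>

lemma Re_sum_log_ratio_le:
  assumes t: "0 < t" "t \<le> 1 / 2" and \<theta>: "\<bar>\<theta>\<bar> \<le> pi"
    and N: "1 / (exp t - 1) - (\<Sum>k<N. exp (- t * real (Suc k))) \<le> 1 / 2"
  shows "Re (\<Sum>k<N. log_ratio_term t \<theta> k) \<le> 1 - 1 / 32 * \<theta>\<^sup>2 / (t * (t\<^sup>2 + \<theta>\<^sup>2))"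
proof -
  define g where "g k = exp (- t * real (Suc k)) * (1 - cos (real (Suc k) * \<theta>))" for k
  obtain B where B: "g sums B" "B \<ge> \<theta>\<^sup>2 / (32 * (t * (t\<^sup>2 + \<theta>\<^sup>2)))"
    using cos_geometric_lower_bound[OF t \<theta>] unfolding g_def by blast
  have E: "(\<lambda>k. exp (- t * real (Suc k))) sums (1 / (exp t - 1))"
    using t by (intro geometric_exp_sums)
  have E2: "(\<lambda>k. 2 * exp (- t * real (Suc (k + N)))) sums (2 * (1 / (exp t - 1) - (\<Sum>k<N. exp (- t * real (Suc k)))))"
    by (intro sums_mult sums_split_initial_segment E)
  have gN: "(\<lambda>k. g (k + N)) sums (B - (\<Sum>k<N. g k))" by (intro sums_split_initial_segment B)
  have "g k \<le> 2 * exp (- t * real (Suc k))" for k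
  proof -
    have "1 - cos (real (Suc k) * \<theta>) \<le> 2" using cos_ge_minus_one[of "real (Suc k) * \<theta>"] by linarith
    hence "exp (- t * real (Suc k)) * (1 - cos (real (Suc k) * \<theta>)) \<le> exp (- t * real (Suc k)) * 2"
      by (intro mult_left_mono) auto
    thus ?thesis by (simp only: g_def mult.commute)
  qed
  hence "B - (\<Sum>k<N. g k) \<le> 2 * (1 / (exp t - 1) - (\<Sum>k<N. exp (- t * real (Suc k))))"
    by (intro sums_le[OF _ gN E2])
  also have "\<dots> \<le> 2 * (1 / 2)" using N by (intro mult_left_mono) auto
  finally have 1: "B - 1 \<le> (\<Sum>k<N. g k)" by simp
  have "Re (\<Sum>k<N. log_ratio_term t \<theta> k) \<le> (\<Sum>k<N. - g k)"
    unfolding Re_sum g_def using Re_log_ratio_term_le[OF t(1)]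
    by (intro sum_mono) (simp add: algebra_simps)
  also have "\<dots> = - (\<Sum>k<N. g k)" by (rule sum_negf)
  finally show ?thesis using 1 B by (simp add: mult_ac)
qed

lemma abs_ln_one_plus_le:
  fixes x :: real
  assumes "\<bar>x\<bar> \<le> 1 / 2"
  shows "\<bar>ln (1 + x)\<bar> \<le> 2 * \<bar>x\<bar>"
proof -
  have "\<bar>ln (1 + x) - x\<bar> \<le> 2 * x\<^sup>2" using assms by (rule abs_ln_one_plus_x_minus_x_bound)
  also have "2 * x\<^sup>2 = 2 * (\<bar>x\<bar> * \<bar>x\<bar>)" by (simp add: power2_eq_square)
  also have "\<bar>x\<bar> * \<bar>x\<bar> \<le> 1 / 2 * \<bar>x\<bar>" using assms by (intro mult_right_mono) auto
  finally show ?thesis by linarith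
qed

text \<open>The three terms come from the moment of order 0, from the Gaussian integral with
  variance parameter pi^2 / (3 t^3), and from the normalisation 2 pi of the coefficient integral.
  The right-hand side is in terms of pi^2 / (3 t) = 2 n t, which is s.\<close>

lemma ln_saddle_constants:
  fixes t :: real
  assumes t: "t > 0"
  shows "ln (t / (2 * pi)) / 2 + ln (6 * t ^ 3 / pi) / 2 - ln (2 * pi)
    = - 2 * ln (pi\<^sup>2 / (3 * t)) - ln (6 * sqrt 3 / pi\<^sup>2)"
proof -
  have "ln (6::real) = ln 2 + ln 3" using ln_mult[of 2 "3::real"] by simp
  thus ?thesis using t
    by (simp add: ln_mult ln_div ln_realpow ln_sqrt field_simps)
qed

lemma num_partitions_asymptotic:
  obtains C :: real where "C > 0" and
    "eventually (\<lambda>n. num_partitions n > 0 \<and>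
       (let s = pi * sqrt (2 * real n / 3) in
        \<bar>ln (num_partitions n) - (s - 2 * ln s - ln (6 * sqrt 3 / pi\<^sup>2))\<bar> \<le> C / s)) sequentially"
proof -
  \<comment> \<open>1 / 32 is the constant of \<open>cos_geometric_lower_bound\<close>. The value
    200 leaves room: the slope of the phase is at most 4 / t + t, the third moment at most 16 pi^2 /
    t^4, and the fourth moment over 24 at most (16 pi^2 / 3) / t^5.\<close>
  obtain C where C: "C > 0" and saddle: "\<And>t b s \<kappa> q z.
    \<lbrakk>0 < t; t \<le> 1; \<bar>b\<bar> \<le> 200 / t; (1 / 32) / t ^ 3 \<le> s; \<bar>\<kappa>\<bar> \<le> 200 / t ^ 4; 0 \<le> q; q \<le> 200 / t ^ 5;
     continuous_on {-pi..pi} (\<lambda>\<theta>. exp (z \<theta>) :: complex);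
     \<And>\<theta>. norm (z \<theta> - Complex (- s * \<theta>\<^sup>2 / 2) (b * \<theta> + \<kappa> * \<theta> ^ 3)) \<le> q * \<theta> ^ 4;
     \<And>\<theta>. \<bar>\<theta>\<bar> \<le> pi \<Longrightarrow> Re (z \<theta>) \<le> 1 - 1 / 32 * \<theta>\<^sup>2 / (t * (t\<^sup>2 + \<theta>\<^sup>2))\<rbrakk>
    \<Longrightarrow> \<bar>Re (integral {-pi..pi} (\<lambda>\<theta>. exp (z \<theta>))) - sqrt (2 * pi / s)\<bar> \<le> C * (t\<^sup>2 * sqrt t)"
    using saddle_point_integral[of "1 / 32" 200] by (metis zero_less_divide_1_iff zero_less_numeral)
  \<comment> \<open>In units of t: 5 + 1 from the moment of order 0 and its truncation, 2 C from the
    error of the integral, and 24 / 2 from the error of the second moment, halved by the square root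
    in the Gaussian integral.\<close>
  define D where "D = 2 * C + 18"
  have main: "num_partitions n > 0 \<and>
      \<bar>ln (num_partitions n) - (2 * n * t - 2 * ln (2 * n * t) - ln (6 * sqrt 3 / pi\<^sup>2))\<bar> \<le> D * t"
    if n: "n > 0" and t_def: "t = pi / sqrt (6 * real n)" and t': "t \<le> 1 / 24" "C * t \<le> 1 / 2" for n :: nat and t :: real
  proof -
    have t: "t > 0" unfolding t_def using n by simp
    have "t\<^sup>2 = pi\<^sup>2 / (6 * n)" by (simp add: t_def power_divide)
    hence n_eq: "real n = pi\<^sup>2 / (6 * t\<^sup>2)" using n t by (simp add: field_simps)
    hence nt: "n * t = pi\<^sup>2 / (6 * t)" using t by (simp add: power2_eq_square)
    define M where "M j N = (\<Sum>k<N. moment_row j t k)" for j N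
    have lim: "M j \<longlonglongrightarrow> moment j t" for j
      using summable_sums[OF summable_moment_row[OF t, of j]]
      by (simp add: sums_def M_def[abs_def] moment_def)
    have near: "eventually (\<lambda>N. \<bar>M j N - moment j t\<bar> < t) sequentially" for j
      using tendstoD[OF lim t] by (simp add: dist_real_def)
    have "(\<lambda>N. \<Sum>k<N. exp (- t * real (Suc k))) \<longlonglongrightarrow> 1 / (exp t - 1)"
      using geometric_exp_sums[OF t] by (simp add: sums_def)
    from tendstoD[OF this, of "1 / 2"]
    have tail: "eventually (\<lambda>N. 1 / (exp t - 1) - (\<Sum>k<N. exp (- t * real (Suc k))) \<le> 1 / 2) sequentially"
    proof (rule eventually_mono)
      show "b - a \<le> 1 / 2" if "dist a b < 1 / 2" for a b :: real using that unfolding dist_real_def abs_less_iff by linarith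
    qed simp
    \<comment> \<open>N may depend on n and t, so truncation is made to cost less than t in the
      moments that need precise values; orders 3 and 4 only need upper bounds, which partial sums
      inherit.\<close>
    have "eventually (\<lambda>N. n \<le> N \<and> \<bar>M 0 N - moment 0 t\<bar> < t \<and> \<bar>M 1 N - moment 1 t\<bar> < t \<and> \<bar>M 2 N - moment 2 t\<bar> < t \<and>
       1 / (exp t - 1) - (\<Sum>k<N. exp (- t * real (Suc k))) \<le> 1 / 2) sequentially"
      by (intro eventually_conj near tail eventually_ge_at_top)
    then obtain N where N: "n \<le> N" "\<bar>M 0 N - moment 0 t\<bar> < t" "\<bar>M 1 N - moment 1 t\<bar> < t" "\<bar>M 2 N - moment 2 t\<bar> < t"
       "1 / (exp t - 1) - (\<Sum>k<N. exp (- t * real (Suc k))) \<le> 1 / 2"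
      by (auto simp: eventually_at_top_linorder)
    have M_le: "0 \<le> M j N" "M j N \<le> moment j t" for j
      using moment_row_nonneg[OF t] sum_le_suminf[OF summable_moment_row[OF t], of "{..<N}" j]
      by (auto simp: M_def moment_def intro!: sum_nonneg)
    define s where "s = M 2 N"
    define z where "z \<theta> = (\<Sum>k<N. log_ratio_term t \<theta> k) + \<i> * of_real (n * \<theta>)" for \<theta> :: real
    define J where "J = integral {-pi..pi} (\<lambda>\<theta>. exp (z \<theta>))"
    have prod_eq: "partition_prod N t \<theta> * exp (of_nat n * Complex t \<theta>) = of_real (exp (M 0 N + n * t)) * exp (z \<theta>)" for \<theta>
      unfolding partition_prod_eq_exp[OF t] z_def M_def[symmetric] exp_of_real[symmetric] exp_add[symmetric]
      by (simp add: Complex_eq algebra_simps)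
    have "of_real (2 * pi * real (num_partitions n)) =
        integral {-pi..pi} (\<lambda>\<theta>. of_real (exp (M 0 N + n * t)) * exp (z \<theta>))"
      using num_partitions_integral[OF t N(1)] unfolding prod_eq by simp
    also have "\<dots> = of_real (exp (M 0 N + n * t)) * J"
      unfolding J_def by (rule integral_mult_right)
    finally have "Re (of_real (2 * pi * real (num_partitions n))) = Re (of_real (exp (M 0 N + n * t)) * J)"
      by simp
    hence p_eq: "2 * pi * real (num_partitions n) = exp (M 0 N + n * t) * Re J" by simp
    have pi2: "9 \<le> pi\<^sup>2" "pi\<^sup>2 \<le> 10"
    proof -
      show "9 \<le> pi\<^sup>2" using power_mono[of 3 pi 2] pi_gt3 by simp
      have "pi \<le> 3.16" using pi_approx by simp
      hence "pi\<^sup>2 \<le> 3.16\<^sup>2" using pi_gt_zero by (intro power_mono) auto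
      thus "pi\<^sup>2 \<le> 10" by (simp add: power2_eq_square)
    qed
    have t1: "t \<le> 1 / t" using t t' by (simp add: field_simps mult_le_one)
    have t2: "t \<le> 1 / t\<^sup>2"
    proof -
      have "t * t\<^sup>2 \<le> 1 * 1" using t t' by (intro mult_mono power_le_one) auto
      thus ?thesis using t by (simp add: field_simps)
    qed
    have s_approx: "\<bar>s - pi\<^sup>2 / (3 * t ^ 3)\<bar> \<le> 34 / t\<^sup>2"
    proof -
      have "34 / t\<^sup>2 = 33 / t\<^sup>2 + 1 / t\<^sup>2" by (simp flip: add_divide_distrib)
      thus ?thesis using N(4) moment_2_approx[OF t] t2 unfolding s_def by linarith
    qed
    have t3: "34 / t\<^sup>2 = 34 * t / t ^ 3" using t by (simp add: power2_eq_square power3_eq_cube)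
    have "1 / t ^ 3 \<le> pi\<^sup>2 / (3 * t ^ 3) - 34 * t / t ^ 3"
    proof -
      have "1 \<le> pi\<^sup>2 / 3 - 34 * t" using pi2 t' by linarith
      hence "1 / t ^ 3 \<le> (pi\<^sup>2 / 3 - 34 * t) / t ^ 3" using t by (intro divide_right_mono) auto
      thus ?thesis by (simp add: diff_divide_distrib)
    qed
    hence s_ge: "1 / t ^ 3 \<le> s" using s_approx t3 by linarith
    have "pi\<^sup>2 / (3 * t ^ 3) + 34 * t / t ^ 3 \<le> 6 / t ^ 3"
    proof -
      have "pi\<^sup>2 / 3 + 34 * t \<le> 6" using pi2 t' by linarith
      hence "(pi\<^sup>2 / 3 + 34 * t) / t ^ 3 \<le> 6 / t ^ 3" using t by (intro divide_right_mono) auto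
      thus ?thesis by (simp add: add_divide_distrib)
    qed
    hence s_le: "s \<le> 6 / t ^ 3" using s_approx t3 by linarith
    have s0: "s > 0" using s_ge t by (meson order.strict_trans2 zero_less_divide_1_iff zero_less_power)
    have "\<bar>Re J - sqrt (2 * pi / s)\<bar> \<le> C * (t\<^sup>2 * sqrt t)"
      unfolding J_def
    proof (rule saddle[where b = "n - M 1 N" and \<kappa> = "M 3 N / 6" and q = "M 4 N / 24"])
      show "\<bar>n - M 1 N\<bar> \<le> 200 / t"
      proof -
        have "\<bar>n - M 1 N\<bar> \<le> 4 / t + t" using moment_1_approx[OF t] N(3) n_eq by linarith
        also have "\<dots> \<le> 200 / t" using t1 t by (simp add: field_simps)
        finally show ?thesis .
      qed
      show "1 / 32 / t ^ 3 \<le> s" using s_ge t by (intro order.trans[OF _ s_ge] divide_right_mono) auto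
      have "M 3 N \<le> fact 3 * 2 ^ Suc 3 * (pi\<^sup>2 / 6) / t ^ Suc 3" using M_le(2) moment_le[OF t] by (rule order.trans)
      also have "\<dots> \<le> 200 / t ^ 4" using t pi2 by (simp add: eval_nat_numeral divide_right_mono)
      finally have "M 3 N \<le> 200 / t ^ 4" .
      thus "\<bar>M 3 N / 6\<bar> \<le> 200 / t ^ 4" using M_le(1)[of 3] by simp
      have "M 4 N \<le> fact 4 * 2 ^ Suc 4 * (pi\<^sup>2 / 6) / t ^ Suc 4" using M_le(2) moment_le[OF t] by (rule order.trans)
      also have "\<dots> = 24 * ((32 * (pi\<^sup>2 / 6)) / t ^ 5)" by (simp add: eval_nat_numeral)
      also have "\<dots> \<le> 24 * (200 / t ^ 5)" using t pi2 by (intro mult_left_mono divide_right_mono) auto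
      finally show "M 4 N / 24 \<le> 200 / t ^ 5" by simp
      show "0 \<le> M 4 N / 24" using M_le(1)[of 4] by simp
      show "continuous_on {-pi..pi} (\<lambda>\<theta>. exp (z \<theta>))"
      \<comment> \<open>Continuity is inherited from the finite product, of which
        \<open>exp (z \<theta>)\<close> is a constant multiple; the logarithm series need not be
        examined.\<close>
      proof -
        have "exp (z \<theta>) = partition_prod N t \<theta> * exp (of_nat n * Complex t \<theta>) / of_real (exp (M 0 N + n * t))" for \<theta>
          unfolding prod_eq by simp
        thus ?thesis using t by (auto intro!: continuous_intros)
      qed
      show "norm (z \<theta> - Complex (- s * \<theta>\<^sup>2 / 2) ((n - M 1 N) * \<theta> + M 3 N / 6 * \<theta> ^ 3)) \<le> M 4 N / 24 * \<theta> ^ 4" for \<theta>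
      proof -
        have "z \<theta> - Complex (- s * \<theta>\<^sup>2 / 2) ((n - M 1 N) * \<theta> + M 3 N / 6 * \<theta> ^ 3) =
          (\<Sum>k<N. log_ratio_term t \<theta> k) - Complex (- M 2 N * \<theta>\<^sup>2 / 2) (- M 1 N * \<theta> + M 3 N / 6 * \<theta> ^ 3)"
          by (simp add: z_def s_def complex_eq_iff algebra_simps)
        thus ?thesis using sum_log_ratio_taylor[OF t] unfolding M_def by metis
      qed
      show "Re (z \<theta>) \<le> 1 - 1 / 32 * \<theta>\<^sup>2 / (t * (t\<^sup>2 + \<theta>\<^sup>2))" if "\<bar>\<theta>\<bar> \<le> pi" for \<theta>
        using Re_sum_log_ratio_le[OF t _ that N(5)] t' by (simp add: z_def)
    qed (use t t' in auto)
    moreover define g where "g = sqrt (2 * pi / s)"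
    ultimately have Jg: "\<bar>Re J - g\<bar> \<le> C * (t\<^sup>2 * sqrt t)" by simp
    have g_ge: "t * sqrt t \<le> g"
    proof -
      have "s * t ^ 3 \<le> 6" using s_le t by (simp add: field_simps)
      hence "t\<^sup>2 * t \<le> 2 * pi / s" using s0 pi_gt3 by (simp add: field_simps eval_nat_numeral)
      hence "sqrt (t\<^sup>2 * t) \<le> g" unfolding g_def by (rule real_sqrt_le_mono)
      thus ?thesis using t by (simp add: real_sqrt_mult)
    qed
    have g0: "g > 0" using s0 by (simp add: g_def)
    define \<eta> where "\<eta> = Re J / g - 1"
    have rel: "\<bar>x / y - 1\<bar> = \<bar>x - y\<bar> / y" if "y > 0" for x y :: real
    proof -
      have "x / y - 1 = (x - y) / y" using that by (simp add: diff_divide_distrib)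
      thus ?thesis using that by simp
    qed
    have "\<bar>\<eta>\<bar> = \<bar>Re J - g\<bar> / g" unfolding \<eta>_def by (rule rel[OF g0])
    also have "\<dots> \<le> C * (t\<^sup>2 * sqrt t) / (t * sqrt t)"
      using Jg g_ge g0 t C by (intro frac_le) auto
    also have "\<dots> = C * t" using t by (simp add: power2_eq_square)
    finally have \<eta>: "\<bar>\<eta>\<bar> \<le> C * t" .
    \<comment> \<open>\<epsilon> is the relative error of the second moment, as \<eta> is that of
      the integral. The thresholds imposed on t keep both at most 1 / 2 in modulus, as the logarithm
      estimate requires.\<close>
    define \<epsilon> where "\<epsilon> = s / (pi\<^sup>2 / (3 * t ^ 3)) - 1"
    have "\<bar>\<epsilon>\<bar> = \<bar>s - pi\<^sup>2 / (3 * t ^ 3)\<bar> / (pi\<^sup>2 / (3 * t ^ 3))"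
      unfolding \<epsilon>_def using t by (intro rel) simp
    also have "\<dots> \<le> (34 / t\<^sup>2) / (9 / (3 * t ^ 3))"
      using s_approx t pi2 by (intro frac_le divide_right_mono) auto
    also have "\<dots> \<le> 12 * t" using t by (simp add: power2_eq_square power3_eq_cube)
    finally have \<epsilon>: "\<bar>\<epsilon>\<bar> \<le> 12 * t" .
    have ln\<eta>: "\<bar>ln (1 + \<eta>)\<bar> \<le> 2 * (C * t)" using abs_ln_one_plus_le[of \<eta>] \<eta> t' by linarith
    have ln\<epsilon>: "\<bar>ln (1 + \<epsilon>)\<bar> \<le> 24 * t" using abs_ln_one_plus_le[of \<epsilon>] \<epsilon> t' by linarith
    have pos: "1 + \<eta> > 0" "1 + \<epsilon> > 0" using \<eta> \<epsilon> t' by linarith+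
    have J_eq: "Re J = g * (1 + \<eta>)" using g0 by (simp add: \<eta>_def)
    have g_eq: "ln g = (ln (6 * t ^ 3 / pi) - ln (1 + \<epsilon>)) / 2"
    proof -
      have "2 * pi / s = (6 * t ^ 3 / pi) / (1 + \<epsilon>)"
        using t s0 by (simp add: \<epsilon>_def field_simps power2_eq_square)
      moreover have "ln ((6 * t ^ 3 / pi) / (1 + \<epsilon>)) = ln (6 * t ^ 3 / pi) - ln (1 + \<epsilon>)"
        using pos t by (subst ln_div) auto
      moreover have "ln g = ln (2 * pi / s) / 2" using s0 by (simp add: g_def ln_sqrt)
      ultimately show ?thesis by simp
    qed
    have p0: "num_partitions n > 0"
    proof -
      have "2 * pi * real (num_partitions n) > 0" unfolding p_eq J_eq using g0 pos by simp
      thus ?thesis by (simp add: zero_less_mult_iff)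
    qed
    define l where "l = ln (num_partitions n)"
    define w where "w = 2 * n * t"
    have w: "pi\<^sup>2 / (6 * t) = w / 2" "n * t = w / 2" "pi\<^sup>2 / (3 * t) = w" using nt by (simp_all add: w_def)
    have "ln (2 * pi) + l = ln (2 * pi * real (num_partitions n))"
      using p0 by (simp add: l_def ln_mult)
    also have "\<dots> = M 0 N + n * t + (ln g + ln (1 + \<eta>))"
      unfolding p_eq J_eq using g0 pos by (simp add: ln_mult)
    finally have l_eq: "ln (2 * pi) + l = M 0 N + w / 2 + (ln g + ln (1 + \<eta>))" unfolding w .
    have M0: "\<bar>M 0 N - (w / 2 + ln (t / (2 * pi)) / 2)\<bar> \<le> 6 * t"
      using N(2) moment_0_approx[OF t] t' unfolding w by linarith
    have c: "ln (t / (2 * pi)) / 2 + ln (6 * t ^ 3 / pi) / 2 - ln (2 * pi) = - 2 * ln w - ln (6 * sqrt 3 / pi\<^sup>2)"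
      using ln_saddle_constants[OF t] unfolding w .
    have "\<bar>l - (w - 2 * ln w - ln (6 * sqrt 3 / pi\<^sup>2))\<bar> \<le> 6 * t + 2 * (C * t) + 12 * t"
    proof -
      have "\<bar>l - (w - 2 * lw - d)\<bar> \<le> 6 * t + 2 * u + 12 * t"
        if "l2 + l = m + w / 2 + (lg + le)" "\<bar>m - (w / 2 + a / 2)\<bar> \<le> 6 * t" "a / 2 + b / 2 - l2 = - 2 * lw - d"
          "\<bar>le\<bar> \<le> 2 * u" "\<bar>lf\<bar> \<le> 24 * t" "lg = (b - lf) / 2"
        for l w lw d t u l2 m lg le a b lf :: real
        using that by (simp add: abs_le_iff field_simps)
      from this[OF l_eq M0 c ln\<eta> ln\<epsilon> g_eq] show ?thesis .
    qed
    thus ?thesis using p0 by (simp add: D_def l_def w_def algebra_simps)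
  qed
  show ?thesis
  proof (rule that[of "D * (pi\<^sup>2 / 3)"])
    show "D * (pi\<^sup>2 / 3) > 0" using C by (simp add: D_def)
    define t where "t n = pi / sqrt (6 * real n)" for n
    have "t \<longlonglongrightarrow> 0" unfolding t_def by real_asymp
    hence "eventually (\<lambda>n. t n < min (1 / 24) (1 / (2 * C))) sequentially"
      using C by (intro order_tendstoD(2)[of t 0]) auto
    thus "eventually (\<lambda>n. num_partitions n > 0 \<and> (let s = pi * sqrt (2 * real n / 3) in
        \<bar>ln (num_partitions n) - (s - 2 * ln s - ln (6 * sqrt 3 / pi\<^sup>2))\<bar> \<le> D * (pi\<^sup>2 / 3) / s)) sequentially"
      using eventually_gt_at_top[of 0]
    proof eventually_elim
      case (elim n)
      have "C * t n \<le> C * (1 / (2 * C))" using elim C by (intro mult_left_mono) auto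
      hence "C * t n \<le> 1 / 2" using C by simp
      have s: "2 * n * t n = pi * sqrt (2 * real n / 3)"
      proof -
        have "sqrt (2 * real n / 3) = 2 * real n / sqrt (6 * real n)"
        proof (rule real_sqrt_unique)
          show "(2 * real n / sqrt (6 * real n))\<^sup>2 = 2 * real n / 3"
            using elim by (simp add: power_divide power_mult_distrib) (simp add: power2_eq_square)
        qed auto
        thus ?thesis by (simp add: t_def)
      qed
      have "D * t n = D * (pi\<^sup>2 / 3) / (2 * n * t n)"
        using elim by (simp add: t_def power2_eq_square field_simps)
      thus ?case
        using main[OF elim(2) t_def] \<open>C * t n \<le> 1 / 2\<close> elim(1) unfolding Let_def s[symmetric] by simp
    qed
  qed
qed

subsection \<open>Counting the values of p(n) - n\<close>

definition log_scale :: "nat \<Rightarrow> real" where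
  "log_scale n = pi * sqrt (2 * real n / 3)"

lemma log_scale_mono: "m \<le> n \<Longrightarrow> log_scale m \<le> log_scale n"
  by (simp add: log_scale_def)

lemma log_scale_at_top: "filterlim log_scale at_top sequentially"
  unfolding log_scale_def by real_asymp

lemma H_Suc_gt: "n \<ge> 4 \<Longrightarrow> H n < H (Suc n)"
  using num_partitions_Suc_ge[of n] by (simp add: H_def)

lemma H_mono:
  assumes "4 \<le> m" "m \<le> n"
  shows "H m \<le> H n"
  using assms(2,1) by (induction rule: dec_induct) (auto intro: order.trans less_imp_le[OF H_Suc_gt])

lemma H_strict_mono:
  assumes "4 \<le> m" "m < n"
  shows "H m < H n"
  using H_Suc_gt[of m] H_mono[of "Suc m" n] assms by linarith

text \<open>As \<open>H\<close> is strictly increasing from 4 on, the indices with H n \<le> x form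
  an initial segment starting at 4, hence the offset. In particular I_count x + 3, when at least 4,
  is the last index with H n \<le> x.\<close>

lemma I_count_less_iff:
  assumes "n \<ge> 4"
  shows "n < I_count x + 4 \<longleftrightarrow> real_of_int (H n) \<le> x"
proof -
  define A where "A = {n. n \<ge> 4 \<and> real_of_int (H n) \<le> x}"
  have inj: "inj_on H A"
    by (rule linorder_inj_onI) (auto simp: A_def dest: H_strict_mono)
  have img: "{m \<in> H_plus. real_of_int m \<le> x} = H ` A"
    by (auto simp: H_plus_def A_def)
  have card: "I_count x = card A" unfolding I_count_def img using inj by (rule card_image)
  have fin: "finite A"
    using finite_I_count[of x] inj unfolding img by (rule finite_imageD)
  have down: "m \<in> A" if "n \<in> A" "4 \<le> m" "m \<le> n" for m n
    using that H_mono[of m n] by (force simp: A_def)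
  have "A = {4..<4 + card A}"
  proof (cases "A = {}")
    case False
    define M where "M = Max A"
    have M: "M \<in> A" "M \<ge> 4" using Max_in[OF fin False] by (auto simp: M_def A_def)
    have "A = {4..M}"
      using down[OF M(1)] fin by (auto simp: M_def A_def)
    moreover from arg_cong[OF this, of card] have "4 + card A = Suc M" using M by simp
    ultimately show ?thesis by (simp only: atLeastLessThanSuc_atLeastAtMost)
  qed simp
  hence "n \<in> A \<longleftrightarrow> n \<in> {4..<4 + card A}" by (rule arg_cong[of _ _ "\<lambda>S. n \<in> S"])
  thus ?thesis using assms by (auto simp: card A_def)
qed

lemma I_count_at_top: "filterlim I_count at_top at_top"
  unfolding filterlim_at_top
proof
  fix m :: nat
  show "eventually (\<lambda>x. m \<le> I_count x) at_top"
    using eventually_ge_at_top[of "real_of_int (H (m + 4))"]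
  proof eventually_elim
    case (elim x)
    thus ?case using I_count_less_iff[of "m + 4" x] by simp
  qed
qed

text \<open>Writing H n = p(n) (1 - u) with u = n / p(n), the correction is ln (1 - u), at most 2 u
  in modulus. Although u is exponentially small in s, the bound u \<le> 1 / s suffices and accounts
  for the 2 added to C.\<close>

lemma ln_H_asymptotic:
  defines "d \<equiv> ln (6 * sqrt 3 / pi\<^sup>2)"
  obtains C :: real where "C > 0" and
    "eventually (\<lambda>n. H n > 0 \<and>
       \<bar>ln (H n) - (log_scale n - 2 * ln (log_scale n) - d)\<bar> \<le> C / log_scale n) sequentially"
proof -
  obtain C where C: "C > 0" and ev: "eventually (\<lambda>n. num_partitions n > 0 \<and>
        \<bar>ln (num_partitions n) - (log_scale n - 2 * ln (log_scale n) - d)\<bar> \<le> C / log_scale n) sequentially"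
    using num_partitions_asymptotic[unfolded Let_def, folded log_scale_def d_def] by blast
  show ?thesis
  proof (rule that[of "C + 2"])
    have "eventually (\<lambda>n. real n * exp (- (log_scale n - 2 * ln (log_scale n) - d - C / log_scale n)) * log_scale n < 1) sequentially"
      unfolding log_scale_def by real_asymp
    moreover have "eventually (\<lambda>n. log_scale n \<ge> 2) sequentially"
      using log_scale_at_top by (auto simp: filterlim_at_top)
    ultimately show "eventually (\<lambda>n. H n > 0 \<and>
       \<bar>ln (H n) - (log_scale n - 2 * ln (log_scale n) - d)\<bar> \<le> (C + 2) / log_scale n) sequentially"
      using ev
    proof eventually_elim
      case (elim n)
      define s where "s = log_scale n"
      define u where "u = real n / real (num_partitions n)"
      have s: "s \<ge> 2" using elim by (simp add: s_def)
      have p: "real (num_partitions n) > 0" using elim by simp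
      have "u = real n * exp (- ln (num_partitions n))"
        using p by (simp add: u_def exp_minus divide_inverse)
      also have "\<dots> \<le> real n * exp (- (s - 2 * ln s - d - C / s))"
        using elim(3) by (intro mult_left_mono) (auto simp: s_def abs_le_iff)
      finally have "u * s \<le> real n * exp (- (s - 2 * ln s - d - C / s)) * s"
        using s by (intro mult_right_mono) auto
      also have "\<dots> < 1" using elim(1) by (simp add: s_def)
      finally have us: "u \<le> 1 / s" using s by (simp add: field_simps)
      also have "\<dots> \<le> 1 / 2" using s by (intro divide_left_mono) auto
      finally have u: "0 \<le> u" "u \<le> 1 / 2" by (auto simp: u_def)
      have H: "real_of_int (H n) = real (num_partitions n) * (1 + - u)"
        using p by (simp add: H_def u_def algebra_simps)
      have Hpos: "real_of_int (H n) > 0" unfolding H using p u by (intro mult_pos_pos) auto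
      have "ln (H n) = ln (num_partitions n) + ln (1 + - u)"
        unfolding H using p u by (subst ln_mult) auto
      moreover have "\<bar>ln (1 + - u)\<bar> \<le> 2 / s" using abs_ln_one_plus_le[of "-u"] u us by simp
      moreover have "(C + 2) / s = C / s + 2 / s" by (simp add: add_divide_distrib)
      moreover have "\<bar>x + y - z\<bar> \<le> p + q" if "\<bar>x - z\<bar> \<le> p" "\<bar>y\<bar> \<le> q" for x y z p q :: real
        using that by linarith
      ultimately show ?case using elim(3) Hpos unfolding s_def by simp
    qed
  qed (use C in simp)
qed

text \<open>Solving L = s - 2 ln s - d gives s = L + 2 ln L + d up to O(ln L / L), because ln s and
  ln L differ by that order; squaring yields \<Psi> up to O((ln L)^2). As \<Psi> is increasing for L
  \<ge> 1, it is enough to treat the two extreme values of L, which are explicit functions of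
  s.\<close>

lemma inverse_expansion:
  fixes d C :: real
  assumes d: "d \<ge> 0"
  defines "\<Psi> \<equiv> \<lambda>L. L\<^sup>2 + 4 * L * ln L + 2 * d * L"
  obtains K where "K > 0" and
    "eventually (\<lambda>s. \<forall>L. \<bar>L - (s - 2 * ln s - d)\<bar> \<le> C / s \<longrightarrow> \<bar>\<Psi> L - s\<^sup>2\<bar> \<le> K * (ln L)\<^sup>2) at_top"
proof -
  have "(\<lambda>s. \<Psi> (s - 2 * ln s - d + C / s) - s\<^sup>2) \<in> O(\<lambda>s. (ln s)\<^sup>2)"
    unfolding \<Psi>_def by real_asymp
  then obtain K1 where K1: "K1 > 0" "eventually (\<lambda>s. norm (\<Psi> (s - 2 * ln s - d + C / s) - s\<^sup>2) \<le> K1 * norm ((ln s)\<^sup>2)) at_top"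
    by (rule landau_o.bigE)
  have "(\<lambda>s. \<Psi> (s - 2 * ln s - d - C / s) - s\<^sup>2) \<in> O(\<lambda>s. (ln s)\<^sup>2)"
    unfolding \<Psi>_def by real_asymp
  then obtain K2 where K2: "K2 > 0" "eventually (\<lambda>s. norm (\<Psi> (s - 2 * ln s - d - C / s) - s\<^sup>2) \<le> K2 * norm ((ln s)\<^sup>2)) at_top"
    by (rule landau_o.bigE)
  have mono: "\<Psi> a \<le> \<Psi> b" if "1 \<le> a" "a \<le> b" for a b
    unfolding \<Psi>_def using that d by (intro add_mono power_mono mult_mono) auto
  \<comment> \<open>This puts the whole range of L into the region L \<ge> 1 and gives ln s \<le> 2
    ln L, which converts the error from s to L at the cost of the factor 4.\<close>
  have ev1: "eventually (\<lambda>s. sqrt s \<le> s - 2 * ln s - d - C / s) at_top" by real_asymp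
  show ?thesis
  proof (rule that[of "4 * (K1 + K2)"])
    show "4 * (K1 + K2) > 0" using K1 K2 by simp
    show "eventually (\<lambda>s. \<forall>L. \<bar>L - (s - 2 * ln s - d)\<bar> \<le> C / s \<longrightarrow> \<bar>\<Psi> L - s\<^sup>2\<bar> \<le> 4 * (K1 + K2) * (ln L)\<^sup>2) at_top"
      using K1(2) K2(2) ev1 eventually_ge_at_top[of 1]
    proof eventually_elim
      case (elim s)
      show ?case
      proof (intro allI impI)
        fix L assume "\<bar>L - (s - 2 * ln s - d)\<bar> \<le> C / s"
        hence L: "s - 2 * ln s - d - C / s \<le> L" "L \<le> s - 2 * ln s - d + C / s" by linarith+
        have sq: "1 \<le> sqrt s" using elim by simp
        have a: "1 \<le> s - 2 * ln s - d - C / s" using elim sq by linarith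
        have "\<Psi> L \<le> \<Psi> (s - 2 * ln s - d + C / s)" using L a by (intro mono) auto
        moreover have "\<Psi> (s - 2 * ln s - d - C / s) \<le> \<Psi> L" using L a by (intro mono) auto
        moreover have "0 \<le> K1 * (ln s)\<^sup>2" "0 \<le> K2 * (ln s)\<^sup>2" using K1 K2 by auto
        ultimately have "\<bar>\<Psi> L - s\<^sup>2\<bar> \<le> (K1 + K2) * (ln s)\<^sup>2"
          using elim(1,2) by (simp add: distrib_right abs_le_iff)
        also have "(ln s)\<^sup>2 \<le> (2 * ln L)\<^sup>2"
        proof (rule power_mono)
          have "ln (sqrt s) \<le> ln L" using L elim sq by (intro ln_mono) auto
          thus "ln s \<le> 2 * ln L" using elim by (simp add: ln_sqrt)
        qed (use elim in simp)
        hence "(K1 + K2) * (ln s)\<^sup>2 \<le> (K1 + K2) * (2 * ln L)\<^sup>2" using K1 K2 by (intro mult_left_mono) auto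
        finally show "\<bar>\<Psi> L - s\<^sup>2\<bar> \<le> 4 * (K1 + K2) * (ln L)\<^sup>2" by (simp add: power_mult_distrib algebra_simps)
      qed
    qed
  qed
qed

text \<open>For n = I_count x + 3 one has H n \<le> x < H (n + 1) once x is large. Since s grows
  like sqrt n, passing from n to n + 1 moves s - 2 ln s by only O(1 / s), so the gap between
  consecutive values disappears in the error.\<close>

lemma ln_I_count:
  defines "d \<equiv> ln (6 * sqrt 3 / pi\<^sup>2)"
  obtains C :: real where
    "eventually (\<lambda>x. \<bar>ln x - (log_scale (I_count x + 3) - 2 * ln (log_scale (I_count x + 3)) - d)\<bar>
        \<le> C / log_scale (I_count x + 3)) at_top"
proof -
  obtain C where C: "C > 0" and ev: "eventually (\<lambda>n. H n > 0 \<and>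
       \<bar>ln (H n) - (log_scale n - 2 * ln (log_scale n) - d)\<bar> \<le> C / log_scale n) sequentially"
    using ln_H_asymptotic[folded d_def] by blast
  define P where "P n \<longleftrightarrow> H n > 0 \<and>
       \<bar>ln (H n) - (log_scale n - 2 * ln (log_scale n) - d)\<bar> \<le> C / log_scale n" for n
  define \<phi> where "\<phi> n = log_scale n - 2 * ln (log_scale n)" for n
  have "(\<lambda>n. \<phi> (Suc n) - \<phi> n) \<in> O(\<lambda>n. 1 / log_scale n)"
    unfolding \<phi>_def log_scale_def by real_asymp
  then obtain K where K: "K > 0" "eventually (\<lambda>n. norm (\<phi> (Suc n) - \<phi> n) \<le> K * norm (1 / log_scale n)) sequentially"
    by (rule landau_o.bigE)
  have evn: "eventually (\<lambda>n. P n \<and> P (Suc n) \<and> norm (\<phi> (Suc n) - \<phi> n) \<le> K * norm (1 / log_scale n) \<and> n \<ge> 4) sequentially"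
    using ev K(2) unfolding P_def[symmetric]
    by (intro eventually_conj eventually_ge_at_top) (simp_all add: eventually_sequentially_Suc)
  have "filterlim (\<lambda>x. I_count x + 3) sequentially at_top"
    by (rule filterlim_compose[OF _ I_count_at_top]) (rule filterlim_add_const_nat_at_top)
  from eventually_compose_filterlim[OF evn this] show ?thesis
  proof (intro that[of "C + K"], eventually_elim)
    case (elim x)
    define n where "n = I_count x + 3"
    define s where "s = log_scale n"
    have n: "n \<ge> 4" "P n" "P (Suc n)" "norm (\<phi> (Suc n) - \<phi> n) \<le> K * norm (1 / s)" using elim by (auto simp: n_def s_def)
    have s: "s > 0" using n by (simp add: s_def log_scale_def)
    have "real_of_int (H n) \<le> x" using I_count_less_iff[of n x] n by (simp add: n_def)
    moreover have "x < real_of_int (H (Suc n))" using I_count_less_iff[of "Suc n" x] n by (simp add: n_def)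
    moreover have "H n > 0" using n by (simp add: P_def)
    ultimately have lnx: "ln (H n) \<le> ln x" "ln x \<le> ln (H (Suc n))" by auto
    have "C / log_scale (Suc n) \<le> C / s"
      using s C log_scale_mono[of n "Suc n"] unfolding s_def by (intro divide_left_mono mult_pos_pos) auto
    hence 1: "ln (H (Suc n)) \<le> \<phi> (Suc n) - d + C / s" using n(3) by (simp add: P_def \<phi>_def abs_le_iff)
    have 2: "\<phi> (Suc n) - \<phi> n \<le> K / s" using n(4) s by simp
    have 3: "ln (H n) \<ge> \<phi> n - d - C / s" using n(2) by (simp add: P_def \<phi>_def s_def abs_le_iff)
    have "(C + K) / s = C / s + K / s" "K / s \<ge> 0" using K s by (simp_all add: add_divide_distrib)
    hence "\<bar>ln x - (\<phi> n - d)\<bar> \<le> (C + K) / s" unfolding abs_le_iff using lnx 1 2 3 by linarith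
    thus ?case by (simp add: \<phi>_def s_def n_def)
  qed
qed

theorem theorem5p2:
  shows "(\<lambda>x. real (I_count x)
            - (3 / (2 * pi\<^sup>2) * (ln x)\<^sup>2
               + 6 / pi\<^sup>2 * ln x * ln (ln x)
               + 3 / pi\<^sup>2 * ln (6 * sqrt 3 / pi\<^sup>2) * ln x))
           \<in> O[at_top](\<lambda>x. (ln (ln x))\<^sup>2)
       \<and> (\<lambda>x. real (I_count x)) \<sim>[at_top] (\<lambda>x. 3 / (2 * pi\<^sup>2) * (ln x)\<^sup>2)"
proof
  define d where "d = ln (6 * sqrt 3 / pi\<^sup>2)"
  \<comment> \<open>The sign is what \<open>inverse_expansion\<close> asks for. The margin is narrow
    with these decimals: 3.2^2 = 10.24 against 6 * 1.71 = 10.26.\<close>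
  have d: "d \<ge> 0"
  proof -
    have "pi\<^sup>2 \<le> (3.2::real)\<^sup>2" using pi_approx by (intro power_mono) auto
    also have "\<dots> \<le> 6 * (1.71::real)" by (simp add: power2_eq_square)
    also have "(1.71::real) \<le> sqrt 3" by (rule real_le_rsqrt) (simp add: power2_eq_square)
    finally show ?thesis unfolding d_def by (intro ln_ge_zero) simp
  qed
  define s where "s x = log_scale (I_count x + 3)" for x
  define \<Psi> where "\<Psi> L = L\<^sup>2 + 4 * L * ln L + 2 * d * L" for L :: real
  obtain C where C: "eventually (\<lambda>x. \<bar>ln x - (s x - 2 * ln (s x) - d)\<bar> \<le> C / s x) at_top"
    using ln_I_count[folded s_def d_def] by blast
  obtain K where K: "K > 0" "eventually (\<lambda>s. \<forall>L. \<bar>L - (s - 2 * ln s - d)\<bar> \<le> C / s \<longrightarrow> \<bar>\<Psi> L - s\<^sup>2\<bar> \<le> K * (ln L)\<^sup>2) at_top"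
    using inverse_expansion[OF d, folded \<Psi>_def] by blast
  have "filterlim (\<lambda>x. I_count x + 3) sequentially at_top"
    by (rule filterlim_compose[OF _ I_count_at_top]) (rule filterlim_add_const_nat_at_top)
  hence s_top: "filterlim s at_top at_top"
    unfolding s_def by (rule filterlim_compose[OF log_scale_at_top])
  have ev: "eventually (\<lambda>x. \<bar>\<Psi> (ln x) - (s x)\<^sup>2\<bar> \<le> K * (ln (ln x))\<^sup>2) at_top"
    using eventually_compose_filterlim[OF K(2) s_top] C by eventually_elim blast
  define R where "R x = real (I_count x)
            - (3 / (2 * pi\<^sup>2) * (ln x)\<^sup>2
               + 6 / pi\<^sup>2 * ln x * ln (ln x)
               + 3 / pi\<^sup>2 * d * ln x)" for x
  \<comment> \<open>Since s^2 = (2 pi^2 / 3) (I_count x + 3), multiplying by 3 / (2 pi^2) recovers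
    the count and turns \<Psi> into exactly the three stated terms; the - 3 is the offset of the
    index.\<close>
  have R: "R x = - (3 / (2 * pi\<^sup>2)) * (\<Psi> (ln x) - (s x)\<^sup>2) - 3" for x
  proof -
    have "(s x)\<^sup>2 = pi\<^sup>2 * (2 * (real (I_count x) + 3) / 3)"
      by (simp add: s_def log_scale_def power_mult_distrib)
    thus ?thesis by (simp add: R_def \<Psi>_def field_simps)
  qed
  have "(\<lambda>x. \<Psi> (ln x) - (s x)\<^sup>2) \<in> O(\<lambda>x. (ln (ln x))\<^sup>2)"
    using ev by (intro bigoI[of _ K]) simp
  hence "(\<lambda>x. - (3 / (2 * pi\<^sup>2)) * (\<Psi> (ln x) - (s x)\<^sup>2)) \<in> O(\<lambda>x. (ln (ln x))\<^sup>2)"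
    by (subst landau_o.big.cmult_in_iff) auto
  moreover have "(\<lambda>x::real. 3 :: real) \<in> O(\<lambda>x. (ln (ln x))\<^sup>2)" by real_asymp
  ultimately have RO: "R \<in> O(\<lambda>x. (ln (ln x))\<^sup>2)"
    unfolding R[abs_def] by (rule sum_in_bigo)
  thus "(\<lambda>x. real (I_count x)
            - (3 / (2 * pi\<^sup>2) * (ln x)\<^sup>2
               + 6 / pi\<^sup>2 * ln x * ln (ln x)
               + 3 / pi\<^sup>2 * ln (6 * sqrt 3 / pi\<^sup>2) * ln x))
           \<in> O[at_top](\<lambda>x. (ln (ln x))\<^sup>2)"
    unfolding R_def[abs_def] d_def .
  have "(\<lambda>x::real. (ln (ln x))\<^sup>2) \<in> o(\<lambda>x. 3 / (2 * pi\<^sup>2) * (ln x)\<^sup>2)" by real_asymp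
  with RO have "R \<in> o(\<lambda>x. 3 / (2 * pi\<^sup>2) * (ln x)\<^sup>2)" by (rule landau_o.big_small_trans)
  moreover have "(\<lambda>x. 6 / pi\<^sup>2 * ln x * ln (ln x) + 3 / pi\<^sup>2 * d * ln x) \<in> o(\<lambda>x. 3 / (2 * pi\<^sup>2) * (ln x)\<^sup>2)"
    by real_asymp
  ultimately have "(\<lambda>x. R x + (6 / pi\<^sup>2 * ln x * ln (ln x) + 3 / pi\<^sup>2 * d * ln x)) \<in> o(\<lambda>x. 3 / (2 * pi\<^sup>2) * (ln x)\<^sup>2)"
    by (rule sum_in_smallo)
  hence "(\<lambda>x. real (I_count x) - 3 / (2 * pi\<^sup>2) * (ln x)\<^sup>2) \<in> o(\<lambda>x. 3 / (2 * pi\<^sup>2) * (ln x)\<^sup>2)"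
    by (simp add: R_def algebra_simps)
  thus "(\<lambda>x. real (I_count x)) \<sim>[at_top] (\<lambda>x. 3 / (2 * pi\<^sup>2) * (ln x)\<^sup>2)"
    by (rule smallo_imp_asymp_equiv)
qed

end
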